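(* Let $(X,d)$ be a compact metric space, $f_{0,\infty}=\{f_n\}_{n=0}^\infty$ a sequence of continuous self-maps of $X$, and $A\in\mathcal{S}$. Then $h_A(f_{0,\infty})=0$ if and only if $h_A(\hat{f}_{0,\infty})=0$. Consequently, $(X,f_{0,\infty})$ is null if and only if $(\mathcal{M}(X),\hat f_{0,\infty})$ is null.
   Context: $f_0^n=f_{n-1}\circ\cdots\circ f_0$, $f_0^0=\mathrm{id}$. $\mathcal S$ is the set of strictly increasing sequences $A=\{a_i\}_{i\ge1}$ of nonnegative integers. For a compact metric space $Z$ and continuous self-maps $g_{0,\infty}$ of $Z$, $h_A(g_{0,\infty})=\sup_{\mathscr A}\limsup_{n\to\infty}\frac1n\log\mathcal N(\bigvee_{i=1}^n (g_0^{a_i})^{-1}\mathscr A)$ over finite open covers $\mathscr A$ of $Z$ ($\bigvee$ = common refinement, $\mathcal N$ = minimal cardinality of a subcover). $\mathcal M(X)$ is the space of Borel probability measures on $X$ with the weak$^*$ topology (a compact metric space, e.g. with the Prohorov metric $\mathcal P_d(\mu,\nu)=\inf\{\epsilon>0:\mu(B)\le\nu(B^\epsilon)+\epsilon\ \forall B \text{ Borel}\}$, $B^\epsilon=\{x:d(x,B)<\epsilon\}$), and $\hat f_{0,\infty}=\{\hat f_n\}$ with $\hat f_n(\mu)(B)=\mu(f_n^{-1}(B))$; each $\hat f_n$ is continuous. A system is null if $h_A=0$ for every $A\in\mathcal S$. *)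

theory Defs
  imports "HOL-Analysis.Analysis" "HOL-Probability.Probability"
begin

primrec comp_seq :: "(nat \<Rightarrow> 'a \<Rightarrow> 'a) \<Rightarrow> nat \<Rightarrow> 'a \<Rightarrow> 'a" where
  "comp_seq g 0 = id"
| "comp_seq g (Suc n) = g n \<circ> comp_seq g n"

definition open_covers :: "'a topology \<Rightarrow> 'a set set set" where
  "open_covers T = {\<A>. finite \<A> \<and> (\<forall>U\<in>\<A>. openin T U) \<and> \<Union>\<A> = topspace T}"

text \<open>The join of the pulled-back covers (g_0^{a_i})^{-1} A for i = 1..n; the sequence
  a_1 < a_2 < ... is represented as a 0 < a 1 < ..., i.e. indices 0..<n.\<close>
definition join_cover ::
  "'a topology \<Rightarrow> (nat \<Rightarrow> 'a \<Rightarrow> 'a) \<Rightarrow> (nat \<Rightarrow> nat) \<Rightarrow> 'a set set \<Rightarrow> nat \<Rightarrow> 'a set set" where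
  "join_cover T g a \<A> n =
     {topspace T \<inter> (\<Inter>i\<in>{..<n}. comp_seq g (a i) -` U i) | U. \<forall>i<n. U i \<in> \<A>}"

definition min_subcover :: "'a topology \<Rightarrow> 'a set set \<Rightarrow> nat" where
  "min_subcover T \<U> = Inf {card \<V> | \<V>. \<V> \<subseteq> \<U> \<and> finite \<V> \<and> topspace T \<subseteq> \<Union>\<V>}"

definition seq_entropy :: "'a topology \<Rightarrow> (nat \<Rightarrow> 'a \<Rightarrow> 'a) \<Rightarrow> (nat \<Rightarrow> nat) \<Rightarrow> ereal" where
  "seq_entropy T g a =
     (SUP \<A> \<in> open_covers T.
        limsup (\<lambda>n. ereal (ln (real (min_subcover T (join_cover T g a \<A> n))) / real n)))"

definition null_system :: "'a topology \<Rightarrow> (nat \<Rightarrow> 'a \<Rightarrow> 'a) \<Rightarrow> bool" where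
  "null_system T g \<longleftrightarrow> (\<forall>a. strict_mono a \<longrightarrow> seq_entropy T g a = 0)"

definition prob_measures :: "'a::topological_space set \<Rightarrow> 'a measure set" where
  "prob_measures X = {\<mu>. prob_space \<mu> \<and> sets \<mu> = sets (restrict_space borel X)}"

definition weak_star_topology :: "'a::topological_space set \<Rightarrow> 'a measure topology" where
  "weak_star_topology X = topology_generated_by
     {{\<mu> \<in> prob_measures X. (\<integral>x. \<phi> x \<partial>\<mu>) \<in> U} | \<phi> U.
        continuous_on X (\<phi> :: 'a \<Rightarrow> real) \<and> open U}"

definition push_seq :: "'a::topological_space set \<Rightarrow> (nat \<Rightarrow> 'a \<Rightarrow> 'a) \<Rightarrow> nat \<Rightarrow> 'a measure \<Rightarrow> 'a measure" where
  "push_seq X f n \<mu> = distr \<mu> (restrict_space borel X) (f n)"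

end

theory Submission
  imports Defs
begin

text \<open>
  Dirac measures embed \<open>X\<close> equivariantly into its measures, so zero entropy passes from measures
  to points. Conversely, a cover of the compact space of measures has a Lebesgue number
  \<open>\<epsilon>\<close> with respect to finitely many test functions \<open>F\<close>. Given \<open>n\<close>, pick \<open>m\<close> points of \<open>X\<close> such
  that every orbit stays, at all times \<open>a i\<close> with \<open>i < n\<close> and as seen by all \<open>\<phi> \<in> F\<close>, close to
  the orbit of one of them; \<open>m\<close> grows subexponentially. By Maurey's empirical method in
  Euclidean space the orbit of every measure stays, at all but \<open>\<eta> n\<close> of these times, \<open>\<epsilon>\<close>-close
  to the orbit of the empirical measure of \<open>K\<close> of the \<open>m\<close> points, where \<open>K\<close> depends on \<open>\<eta>\<close> and
  \<open>\<epsilon>\<close> but not on \<open>n\<close>. Hence \<open>m\<^sup>K\<close> times the size of a Hamming ball of radius \<open>\<eta> n\<close> bounds the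
  size of a subcover, and the exponential growth rate of this bound tends to \<open>0\<close> with \<open>\<eta>\<close>.
\<close>

subsection \<open>Subexponential growth\<close>

definition subexponential :: "(nat \<Rightarrow> nat) \<Rightarrow> bool" where
  "subexponential u \<longleftrightarrow> (\<forall>\<gamma>>0. \<forall>\<^sub>F n in sequentially. real (u n) \<le> exp (\<gamma> * real n))"

lemma subexponential_mono:
  assumes "subexponential v" "\<And>n. u n \<le> v n"
  shows "subexponential u"
  unfolding subexponential_def
proof (intro allI impI)
  fix \<gamma> :: real assume "\<gamma> > 0"
  then have "\<forall>\<^sub>F n in sequentially. real (v n) \<le> exp (\<gamma> * real n)"
    using assms(1) by (simp add: subexponential_def)
  then show "\<forall>\<^sub>F n in sequentially. real (u n) \<le> exp (\<gamma> * real n)"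
    by eventually_elim (use assms(2) in \<open>meson of_nat_mono order_trans\<close>)
qed

lemma subexponential_if_le_power_times_exp:
  assumes "\<And>\<gamma>. \<gamma> > 0 \<Longrightarrow>
    \<exists>v K. subexponential v \<and> (\<forall>n. real (u n) \<le> real (v n) ^ K * exp (\<gamma> * real n))"
  shows "subexponential u"
  unfolding subexponential_def
proof (intro allI impI)
  fix \<gamma> :: real assume "\<gamma> > 0"
  then obtain v K where v: "subexponential v"
    and u_le: "\<And>n. real (u n) \<le> real (v n) ^ K * exp (\<gamma> / 2 * real n)"
    using assms[of "\<gamma> / 2"] by auto
  define \<delta> where "\<delta> = \<gamma> / (2 * real (Suc K))"
  have "\<delta> > 0" using \<open>\<gamma> > 0\<close> by (simp add: \<delta>_def)
  then have "real K * \<delta> \<le> real (Suc K) * \<delta>" by simp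
  also have "\<dots> = \<gamma> / 2" unfolding \<delta>_def by (simp del: of_nat_Suc)
  finally have K\<delta>: "real K * \<delta> \<le> \<gamma> / 2" .
  have "\<forall>\<^sub>F n in sequentially. real (v n) \<le> exp (\<delta> * real n)"
    using v \<open>\<delta> > 0\<close> by (simp add: subexponential_def)
  then show "\<forall>\<^sub>F n in sequentially. real (u n) \<le> exp (\<gamma> * real n)"
  proof eventually_elim
    case (elim n)
    have "real (v n) ^ K \<le> exp (\<delta> * real n) ^ K"
      using elim by (intro power_mono) auto
    also have "\<dots> = exp (real K * \<delta> * real n)"
      by (simp add: exp_of_nat_mult mult.assoc)
    also have "\<dots> \<le> exp (\<gamma> / 2 * real n)"
      using mult_right_mono[OF K\<delta>, of "real n"] by simp
    finally have "real (v n) ^ K * exp (\<gamma> / 2 * real n)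
        \<le> exp (\<gamma> / 2 * real n) * exp (\<gamma> / 2 * real n)"
      by simp
    also have "\<dots> = exp (\<gamma> * real n)"
      by (simp flip: exp_add)
    finally show ?case using u_le[of n] by linarith
  qed
qed

lemma ln_of_nat_div_le_iff:
  assumes "n > 0" "\<gamma> \<ge> 0"
  shows "ln (real m) / real n \<le> \<gamma> \<longleftrightarrow> real m \<le> exp (\<gamma> * real n)"
proof (cases "m = 0")
  case True
  then show ?thesis using assms by (simp add: less_imp_le)
next
  case False
  then have "ln (real m) \<le> \<gamma> * real n \<longleftrightarrow> real m \<le> exp (\<gamma> * real n)"
    by (simp flip: exp_le_cancel_iff[of "ln (real m)"])
  then show ?thesis using assms by (simp add: divide_le_eq)
qed

lemma limsup_growth_rate_le_0_iff_subexponential: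
  "limsup (\<lambda>n. ereal (ln (real (u n)) / real n)) \<le> 0 \<longleftrightarrow> subexponential u" (is "limsup ?r \<le> 0 \<longleftrightarrow> _")
proof
  assume lim: "limsup ?r \<le> 0"
  show "subexponential u"
    unfolding subexponential_def
  proof (intro allI impI)
    fix \<gamma> :: real assume "\<gamma> > 0"
    then have "\<forall>\<^sub>F n in sequentially. ?r n < ereal \<gamma>"
      using lim[unfolded Limsup_le_iff, rule_format, of "ereal \<gamma>"] by simp
    then show "\<forall>\<^sub>F n in sequentially. real (u n) \<le> exp (\<gamma> * real n)"
      using eventually_gt_at_top[of 0]
      by eventually_elim (use \<open>\<gamma> > 0\<close> in \<open>simp flip: ln_of_nat_div_le_iff\<close>)
  qed
next
  assume u: "subexponential u"
  have "limsup ?r \<le> 0 + ereal \<gamma>" if "\<gamma> > 0" for \<gamma>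
  proof -
    have "\<forall>\<^sub>F n in sequentially. real (u n) \<le> exp (\<gamma> * real n)"
      using u that by (simp add: subexponential_def)
    then have "\<forall>\<^sub>F n in sequentially. ?r n \<le> ereal \<gamma>"
      using eventually_gt_at_top[of 0]
      by eventually_elim (use that in \<open>simp add: ln_of_nat_div_le_iff\<close>)
    then show ?thesis by (simp add: Limsup_bounded)
  qed
  then show "limsup ?r \<le> 0" using ereal_le_epsilon2 by blast
qed

subsection \<open>Joins of pulled-back covers\<close>

abbreviation join_number ::
  "'a topology \<Rightarrow> (nat \<Rightarrow> 'a \<Rightarrow> 'a) \<Rightarrow> (nat \<Rightarrow> nat) \<Rightarrow> 'a set set \<Rightarrow> nat \<Rightarrow> nat" where
  "join_number T g a \<A> n \<equiv> min_subcover T (join_cover T g a \<A> n)"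

lemma seq_entropy_eq_0_iff:
  "seq_entropy T g a = 0 \<longleftrightarrow> (\<forall>\<A>\<in>open_covers T. subexponential (join_number T g a \<A>))"
proof -
  define rate where
    "rate \<A> = limsup (\<lambda>n. ereal (ln (real (join_number T g a \<A> n)) / real n))" for \<A>
  have entropy_def: "seq_entropy T g a = (SUP \<A>\<in>open_covers T. rate \<A>)"
    by (simp add: seq_entropy_def rate_def)
  have ln_nonneg: "0 \<le> ln (real m)" for m by (cases m) auto
  have "0 \<le> rate {topspace T}"
    unfolding rate_def by (intro le_Limsup) (auto simp: ln_nonneg intro!: always_eventually)
  moreover have "{topspace T} \<in> open_covers T" by (simp add: open_covers_def)
  ultimately have "0 \<le> seq_entropy T g a" unfolding entropy_def by (intro SUP_upper2)
  then have "seq_entropy T g a = 0 \<longleftrightarrow> (\<forall>\<A>\<in>open_covers T. rate \<A> \<le> 0)"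
    unfolding entropy_def by (auto simp: antisym simp flip: SUP_le_iff)
  then show ?thesis
    by (simp add: rate_def limsup_growth_rate_le_0_iff_subexponential)
qed

lemma comp_seq_in:
  assumes "\<And>n. g n \<in> S \<rightarrow> S" "x \<in> S"
  shows "comp_seq g n x \<in> S"
  using assms by (induction n) (auto simp: Pi_iff)

text \<open>An element of the join is encoded by the itinerary of cover elements it visits.\<close>

lemma join_number_le_card:
  assumes "finite I"
    and itinerary: "\<And>k i. k \<in> I \<Longrightarrow> i < n \<Longrightarrow> U k i \<in> \<A>"
    and covers: "\<And>x. x \<in> topspace T \<Longrightarrow> \<exists>k\<in>I. \<forall>i<n. comp_seq g (a i) x \<in> U k i"
  shows "join_number T g a \<A> n \<le> card I"
proof -
  define V where "V k = topspace T \<inter> (\<Inter>i\<in>{..<n}. comp_seq g (a i) -` U k i)" for k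
  have "V ` I \<subseteq> join_cover T g a \<A> n"
    using itinerary unfolding V_def join_cover_def by blast
  moreover have "topspace T \<subseteq> \<Union>(V ` I)"
    using covers by (force simp: V_def)
  ultimately have "join_number T g a \<A> n \<le> card (V ` I)"
    unfolding min_subcover_def using \<open>finite I\<close> by (intro cInf_lower) auto
  also have "\<dots> \<le> card I" using \<open>finite I\<close> by (rule card_image_le)
  finally show ?thesis .
qed

lemma finite_join_cover:
  assumes "finite \<A>"
  shows "finite (join_cover T g a \<A> n)"
proof (rule finite_surj)
  let ?meet = "\<lambda>U. topspace T \<inter> (\<Inter>i\<in>{..<n}. comp_seq g (a i) -` U i)"
  show "finite ({..<n} \<rightarrow>\<^sub>E \<A>)" using assms by (simp add: finite_PiE)
  show "join_cover T g a \<A> n \<subseteq> ?meet ` ({..<n} \<rightarrow>\<^sub>E \<A>)"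
  proof
    fix V assume "V \<in> join_cover T g a \<A> n"
    then obtain U where "V = ?meet U" "\<forall>i<n. U i \<in> \<A>" by (auto simp: join_cover_def)
    then show "V \<in> ?meet ` ({..<n} \<rightarrow>\<^sub>E \<A>)"
      by (intro image_eqI[of _ _ "restrict U {..<n}"]) auto
  qed
qed

lemma topspace_subset_Union_join_cover:
  assumes "\<A> \<in> open_covers T" and g: "\<And>n. g n \<in> topspace T \<rightarrow> topspace T"
  shows "topspace T \<subseteq> \<Union>(join_cover T g a \<A> n)"
proof
  fix x assume x: "x \<in> topspace T"
  then have "\<exists>U\<in>\<A>. comp_seq g (a i) x \<in> U" for i
    using comp_seq_in[of g, OF g x, of "a i"] assms(1) by (auto simp: open_covers_def)
  then obtain U where "\<And>i. U i \<in> \<A>" "\<And>i. comp_seq g (a i) x \<in> U i"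
    by metis
  then show "x \<in> \<Union>(join_cover T g a \<A> n)"
    using x unfolding join_cover_def by blast
qed

lemma join_number_attained:
  assumes \<A>: "\<A> \<in> open_covers T" and g: "\<And>n. g n \<in> topspace T \<rightarrow> topspace T"
  obtains I where "finite I" "card I \<le> join_number T g a \<A> n"
    "\<And>U i. U \<in> I \<Longrightarrow> i < n \<Longrightarrow> U i \<in> \<A>"
    "\<And>x. x \<in> topspace T \<Longrightarrow> \<exists>U\<in>I. \<forall>i<n. comp_seq g (a i) x \<in> U i"
proof -
  have "finite (join_cover T g a \<A> n)"
    using \<A> by (simp add: open_covers_def finite_join_cover)
  then have "join_number T g a \<A> n \<in>
      {card \<V> | \<V>. \<V> \<subseteq> join_cover T g a \<A> n \<and> finite \<V> \<and> topspace T \<subseteq> \<Union>\<V>}"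
    unfolding min_subcover_def
    using topspace_subset_Union_join_cover[where g = g, OF \<A> g] by (intro Inf_nat_def1) blast
  then obtain \<V> where \<V>: "\<V> \<subseteq> join_cover T g a \<A> n" "finite \<V>" "topspace T \<subseteq> \<Union>\<V>"
    "card \<V> = join_number T g a \<A> n" by auto
  have "\<forall>V\<in>\<V>. \<exists>U. V = topspace T \<inter> (\<Inter>i\<in>{..<n}. comp_seq g (a i) -` U i) \<and> (\<forall>i<n. U i \<in> \<A>)"
    using \<V>(1) by (auto simp: join_cover_def)
  then obtain U where
    U: "\<And>V. V \<in> \<V> \<Longrightarrow> V = topspace T \<inter> (\<Inter>i\<in>{..<n}. comp_seq g (a i) -` U V i)"
      "\<And>V i. V \<in> \<V> \<Longrightarrow> i < n \<Longrightarrow> U V i \<in> \<A>"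
    by metis
  show ?thesis
  proof (rule that[of "U ` \<V>"])
    show "card (U ` \<V>) \<le> join_number T g a \<A> n"
      using \<V>(2,4) card_image_le by metis
    show "\<exists>U'\<in>U ` \<V>. \<forall>i<n. comp_seq g (a i) x \<in> U' i" if "x \<in> topspace T" for x
    proof -
      obtain V where "V \<in> \<V>" "x \<in> V" using \<open>x \<in> topspace T\<close> \<V>(3) by auto
      then show ?thesis using U(1) by blast
    qed
  qed (use \<V>(2) U(2) in auto)
qed

lemma comp_seq_semiconjugate:
  assumes g: "\<And>n. g n \<in> S \<rightarrow> S" and semiconj: "\<And>n x. x \<in> S \<Longrightarrow> e (g n x) = h n (e x)"
    and "x \<in> S"
  shows "e (comp_seq g n x) = comp_seq h n (e x)"
  using comp_seq_in[of g, OF g \<open>x \<in> S\<close>] by (induction n) (auto simp: semiconj)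

lemma join_number_semiconjugate_le:
  assumes \<V>: "\<V> \<in> open_covers T'"
    and h: "\<And>n. h n \<in> topspace T' \<rightarrow> topspace T'"
    and g: "\<And>n. g n \<in> topspace T \<rightarrow> topspace T"
    and e: "e \<in> topspace T \<rightarrow> topspace T'"
    and semiconj: "\<And>n x. x \<in> topspace T \<Longrightarrow> e (g n x) = h n (e x)"
    and refines: "\<And>V. V \<in> \<V> \<Longrightarrow> \<exists>U\<in>\<U>. \<forall>x\<in>topspace T. e x \<in> V \<longrightarrow> x \<in> U"
  shows "join_number T g a \<U> n \<le> join_number T' h a \<V> n"
proof -
  obtain I where I: "finite I" "card I \<le> join_number T' h a \<V> n"
      "\<And>V i. V \<in> I \<Longrightarrow> i < n \<Longrightarrow> V i \<in> \<V>"
      "\<And>y. y \<in> topspace T' \<Longrightarrow> \<exists>V\<in>I. \<forall>i<n. comp_seq h (a i) y \<in> V i"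
    using join_number_attained[of \<V> T' h a n, OF \<V> h] by blast
  obtain U where U: "\<And>V. V \<in> \<V> \<Longrightarrow> U V \<in> \<U>"
      "\<And>V x. V \<in> \<V> \<Longrightarrow> x \<in> topspace T \<Longrightarrow> e x \<in> V \<Longrightarrow> x \<in> U V"
    using refines by metis
  have "join_number T g a \<U> n \<le> card I"
  proof (rule join_number_le_card[where U = "\<lambda>V i. U (V i)"])
    fix x assume x: "x \<in> topspace T"
    then obtain V where V: "V \<in> I" "\<forall>i<n. comp_seq h (a i) (e x) \<in> V i"
      using I(4) e by blast
    have "comp_seq g (a i) x \<in> U (V i)" if "i < n" for i
    proof (rule U(2))
      show "comp_seq g (a i) x \<in> topspace T" by (rule comp_seq_in[of g, OF g x])
      show "e (comp_seq g (a i) x) \<in> V i"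
        using V that comp_seq_semiconjugate[where e = e and h = h, OF g semiconj x] by simp
    qed (use I V that in auto)
    then show "\<exists>V\<in>I. \<forall>i<n. comp_seq g (a i) x \<in> U (V i)" using V(1) by blast
  qed (use I(1,3) U(1) in auto)
  then show ?thesis using I(2) by simp
qed

lemma ex_join_spanning_set:
  assumes \<A>: "\<A> \<in> open_covers T" and g: "\<And>n. g n \<in> topspace T \<rightarrow> topspace T"
  obtains R where "finite R" "R \<subseteq> topspace T" "card R \<le> join_number T g a \<A> n"
    "\<And>x. x \<in> topspace T \<Longrightarrow>
       \<exists>r\<in>R. \<forall>i<n. \<exists>A\<in>\<A>. comp_seq g (a i) x \<in> A \<and> comp_seq g (a i) r \<in> A"
proof -
  obtain I where I: "finite I" "card I \<le> join_number T g a \<A> n"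
      "\<And>U i. U \<in> I \<Longrightarrow> i < n \<Longrightarrow> U i \<in> \<A>"
      "\<And>x. x \<in> topspace T \<Longrightarrow> \<exists>U\<in>I. \<forall>i<n. comp_seq g (a i) x \<in> U i"
    using join_number_attained[of \<A> T g a n, OF \<A> g] by blast
  define realizes where "realizes U x \<longleftrightarrow> x \<in> topspace T \<and> (\<forall>i<n. comp_seq g (a i) x \<in> U i)" for U x
  define J where "J = {U \<in> I. \<exists>x. realizes U x}"
  obtain r where r: "\<And>U. U \<in> J \<Longrightarrow> realizes U (r U)"
    using bchoice[of J realizes] by (auto simp: J_def)
  show ?thesis
  proof (rule that[of "r ` J"])
    show "finite (r ` J)" using I(1) by (simp add: J_def)
    show "r ` J \<subseteq> topspace T" using r by (auto simp: realizes_def)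
    have "card (r ` J) \<le> card J" "card J \<le> card I"
      using I(1) by (auto simp: J_def intro: card_image_le card_mono)
    then show "card (r ` J) \<le> join_number T g a \<A> n" using I(2) by linarith
    fix x assume "x \<in> topspace T"
    then obtain U where "U \<in> I" "realizes U x" using I(4) unfolding realizes_def by blast
    then have "U \<in> J" by (auto simp: J_def)
    then show "\<exists>r\<in>r ` J. \<forall>i<n. \<exists>A\<in>\<A>. comp_seq g (a i) x \<in> A \<and> comp_seq g (a i) r \<in> A"
      using r[OF \<open>U \<in> J\<close>] I(3)[OF \<open>U \<in> I\<close>] \<open>realizes U x\<close> unfolding realizes_def by blast
  qed
qed

subsection \<open>Borel probability measures on a subspace\<close>

abbreviation borel_on :: "'a::topological_space set \<Rightarrow> 'a measure" where
  "borel_on X \<equiv> restrict_space borel X"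

lemma space_borel_on [simp]: "space (borel_on X) = X"
  by (simp add: space_restrict_space)

lemma prob_measuresD:
  assumes "\<mu> \<in> prob_measures X"
  shows "prob_space \<mu>" "sets \<mu> = sets (borel_on X)" "space \<mu> = X"
  using assms sets_eq_imp_space_eq[of \<mu> "borel_on X"] by (auto simp: prob_measures_def)

lemma distr_in_prob_measures:
  assumes "prob_space M" "y \<in> measurable M (borel_on X)"
  shows "distr M (borel_on X) y \<in> prob_measures X"
  using assms by (simp add: prob_measures_def prob_space.prob_space_distr)

lemma return_in_prob_measures: "x \<in> X \<Longrightarrow> return (borel_on X) x \<in> prob_measures X"
  by (simp add: prob_measures_def prob_space_return)

lemma borel_measurable_prob_measures:
  assumes "\<mu> \<in> prob_measures X" "continuous_on X \<phi>"
  shows "\<phi> \<in> borel_measurable \<mu>"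
  using borel_measurable_continuous_on_restrict[OF assms(2)] prob_measuresD(2)[OF assms(1)]
  by (simp cong: measurable_cong_sets)

lemma measurable_borel_on:
  assumes "continuous_on X g" "g \<in> X \<rightarrow> Y"
  shows "g \<in> measurable (borel_on X) (borel_on Y)"
  using borel_measurable_continuous_on_restrict[OF assms(1)] assms(2)
  by (intro measurable_restrict_space2) auto

lemma measurable_prob_measures:
  assumes "\<mu> \<in> prob_measures X" "continuous_on X g" "g \<in> X \<rightarrow> Y"
  shows "g \<in> measurable \<mu> (borel_on Y)"
  using measurable_borel_on[OF assms(2,3)] prob_measuresD(2)[OF assms(1)]
  by (simp cong: measurable_cong_sets)

lemma integrable_prob_measures:
  fixes \<phi> :: "'a::topological_space \<Rightarrow> real"
  assumes "\<mu> \<in> prob_measures X" "continuous_on X \<phi>" "bounded (\<phi> ` X)"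
  shows "integrable \<mu> \<phi>"
proof -
  interpret prob_space \<mu> using assms(1) by (rule prob_measuresD)
  obtain b where "\<And>x. x \<in> X \<Longrightarrow> \<bar>\<phi> x\<bar> \<le> b" using assms(3) by (auto simp: bounded_real)
  then show ?thesis
    using assms prob_measuresD(3) borel_measurable_prob_measures
    by (intro integrable_const_bound[of _ b]) auto
qed

lemma ex_positive_integral:
  fixes X :: "'a::topological_space set" and \<phi> :: "'i \<Rightarrow> 'a \<Rightarrow> real"
  assumes \<mu>: "\<mu> \<in> prob_measures X" and "finite I"
    and \<phi>: "\<And>i. i \<in> I \<Longrightarrow> continuous_on X (\<phi> i)" "\<And>i. i \<in> I \<Longrightarrow> bounded (\<phi> i ` X)"
      "\<And>i x. i \<in> I \<Longrightarrow> x \<in> X \<Longrightarrow> 0 \<le> \<phi> i x"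
    and positive: "\<And>x. x \<in> X \<Longrightarrow> \<exists>i\<in>I. 0 < \<phi> i x"
  shows "\<exists>i\<in>I. 0 < (\<integral>x. \<phi> i x \<partial>\<mu>)"
proof (rule ccontr)
  assume "\<not> ?thesis"
  then have "(\<Sum>i\<in>I. \<integral>x. \<phi> i x \<partial>\<mu>) \<le> 0" by (intro sum_nonpos) (auto simp: not_less)
  interpret prob_space \<mu> using \<mu> by (rule prob_measuresD)
  have int: "integrable \<mu> (\<phi> i)" if "i \<in> I" for i
    using \<mu> \<phi>(1,2)[OF that] by (rule integrable_prob_measures)
  have "0 < (\<Sum>i\<in>I. \<phi> i x)" if x: "x \<in> X" for x
  proof -
    obtain i where "i \<in> I" "0 < \<phi> i x" using positive x by blast
    then show ?thesis using \<open>finite I\<close> \<phi>(3) x by (intro sum_pos2[of _ i]) auto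
  qed
  then have "0 < (\<integral>x. (\<Sum>i\<in>I. \<phi> i x) \<partial>\<mu>)"
    using int by (intro expectation_greater AE_I2) (auto simp: prob_measuresD(3)[OF \<mu>])
  also have "\<dots> = (\<Sum>i\<in>I. \<integral>x. \<phi> i x \<partial>\<mu>)" using int by simp
  finally show False using \<open>(\<Sum>i\<in>I. \<integral>x. \<phi> i x \<partial>\<mu>) \<le> 0\<close> by simp
qed

lemma ex_continuous_positive_exactly_on:
  fixes X :: "'a::metric_space set"
  assumes "openin (top_of_set X) U"
  shows "\<exists>\<phi> :: 'a \<Rightarrow> real. continuous_on X \<phi> \<and> (\<forall>x. 0 \<le> \<phi> x) \<and> (\<forall>x\<in>X. 0 < \<phi> x \<longleftrightarrow> x \<in> U)"
proof -
  obtain S where S: "open S" "U = X \<inter> S" using assms by (auto simp: openin_open)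
  show ?thesis
  proof (cases "S = UNIV")
    case True
    then show ?thesis using S by (intro exI[of _ "\<lambda>_. 1"]) auto
  next
    case False
    then have "0 < infdist x (- S) \<longleftrightarrow> x \<in> S" for x
      using in_closed_iff_infdist_zero[of "- S" x] S(1) infdist_nonneg[of x "- S"]
      by (auto simp: less_le)
    then show ?thesis
      using S by (intro exI[of _ "\<lambda>x. infdist x (- S)"])
        (auto intro!: continuous_intros simp: infdist_nonneg)
  qed
qed

lemma sets_borel_on: "sets (borel_on X) = sigma_sets X {U. openin (top_of_set X) U}"
proof -
  have "sets (borel_on X) = {(\<lambda>x. x) -` A \<inter> X | A. A \<in> sigma_sets UNIV {S. open S}}"
    by (auto simp: sets_restrict_space sets_borel)
  also have "\<dots> = sigma_sets X {(\<lambda>x. x) -` A \<inter> X | A. A \<in> {S. open S}}"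
    by (rule sigma_sets_vimage_commute) simp
  also have "{(\<lambda>x. x) -` A \<inter> X | A. A \<in> {S. open S}} = {U. openin (top_of_set X) U}"
    by (auto simp: openin_open)
  finally show ?thesis .
qed

lemma indicator_open_limit_of_continuous:
  fixes X :: "'a::metric_space set"
  assumes U: "openin (top_of_set X) U"
  shows "\<exists>\<psi> :: nat \<Rightarrow> 'a \<Rightarrow> real. (\<forall>n. continuous_on X (\<psi> n)) \<and> (\<forall>n x. \<bar>\<psi> n x\<bar> \<le> 1) \<and>
    (\<forall>x\<in>X. (\<lambda>n. \<psi> n x) \<longlonglongrightarrow> indicator U x)"
proof -
  obtain \<phi> :: "'a \<Rightarrow> real" where \<phi>: "continuous_on X \<phi>" "\<And>x. 0 \<le> \<phi> x"
      "\<And>x. x \<in> X \<Longrightarrow> 0 < \<phi> x \<longleftrightarrow> x \<in> U"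
    using ex_continuous_positive_exactly_on[OF U] by blast
  define \<psi> where "\<psi> n x = min 1 (real n * \<phi> x)" for n x
  show ?thesis
  proof (intro exI[of _ \<psi>] conjI allI ballI)
    show "continuous_on X (\<psi> n)" for n
      unfolding \<psi>_def by (intro continuous_intros \<phi>)
    show "\<bar>\<psi> n x\<bar> \<le> 1" for n x using \<phi>(2) by (simp add: \<psi>_def)
    fix x assume "x \<in> X"
    show "(\<lambda>n. \<psi> n x) \<longlonglongrightarrow> indicator U x"
    proof (cases "x \<in> U")
      case True
      then obtain N where N: "1 < real N * \<phi> x" using \<phi>(3) \<open>x \<in> X\<close> reals_Archimedean3 by blast
      have "\<forall>\<^sub>F n in sequentially. \<psi> n x = 1"
        using eventually_ge_at_top[of N]
      proof eventually_elim
        case (elim n)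
        then have "real N * \<phi> x \<le> real n * \<phi> x" using \<phi>(2) by (simp add: mult_right_mono)
        then show ?case using N by (simp add: \<psi>_def)
      qed
      then show ?thesis using True by (simp add: tendsto_eventually)
    next
      case False
      then have "\<phi> x = 0" using \<phi>(2)[of x] \<phi>(3)[OF \<open>x \<in> X\<close>] by simp
      then show ?thesis using False by (simp add: \<psi>_def)
    qed
  qed
qed

lemma prob_measures_eqI:
  fixes X :: "'a::metric_space set"
  assumes \<mu>: "\<mu> \<in> prob_measures X" and \<nu>: "\<nu> \<in> prob_measures X"
    and eq: "\<And>\<phi> :: 'a \<Rightarrow> real. continuous_on X \<phi> \<Longrightarrow> bounded (\<phi> ` X) \<Longrightarrow>
      (\<integral>x. \<phi> x \<partial>\<mu>) = (\<integral>x. \<phi> x \<partial>\<nu>)"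
  shows "\<mu> = \<nu>"
proof -
  interpret \<mu>: prob_space \<mu> using \<mu> by (rule prob_measuresD)
  interpret \<nu>: prob_space \<nu> using \<nu> by (rule prob_measuresD)
  let ?opens = "{U. openin (top_of_set X) U}"
  have "measure \<mu> U = measure \<nu> U" if U: "openin (top_of_set X) U" for U
  proof -
    obtain \<psi> :: "nat \<Rightarrow> 'a \<Rightarrow> real" where \<psi>: "\<And>n. continuous_on X (\<psi> n)" "\<And>n x. \<bar>\<psi> n x\<bar> \<le> 1"
        "\<And>x. x \<in> X \<Longrightarrow> (\<lambda>n. \<psi> n x) \<longlonglongrightarrow> indicator U x"
      using indicator_open_limit_of_continuous[OF U] by blast
    have lim: "(\<lambda>n. \<integral>x. \<psi> n x \<partial>\<rho>) \<longlonglongrightarrow> measure \<rho> U" if \<rho>: "\<rho> \<in> prob_measures X" for \<rho>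
    proof -
      interpret prob_space \<rho> using \<rho> by (rule prob_measuresD)
      have sets: "U \<in> sets \<rho>"
        using U prob_measuresD(2)[OF \<rho>] by (auto simp: sets_borel_on)
      have "(\<lambda>n. \<integral>x. \<psi> n x \<partial>\<rho>) \<longlonglongrightarrow> (\<integral>x. indicator U x \<partial>\<rho>)"
        using sets \<psi> prob_measuresD(3)[OF \<rho>] borel_measurable_prob_measures[OF \<rho> \<psi>(1)]
        by (intro integral_dominated_convergence[where w = "\<lambda>_. 1"]) auto
      then show ?thesis using sets by (simp add: Int_absorb2 sets.sets_into_space)
    qed
    have "(\<integral>x. \<psi> n x \<partial>\<mu>) = (\<integral>x. \<psi> n x \<partial>\<nu>)" for n
      using \<psi>(1,2) by (intro eq) (auto simp: bounded_real)
    then show ?thesis using LIMSEQ_unique[OF lim[OF \<mu>]] lim[OF \<nu>] by simp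
  qed
  moreover have "Int_stable ?opens" by (auto simp: Int_stable_def)
  moreover have "?opens \<subseteq> Pow X" using openin_imp_subset by auto
  ultimately show ?thesis
    using prob_measuresD(2)[OF \<mu>] prob_measuresD(2)[OF \<nu>]
    by (intro measure_eqI_generator_eq[of ?opens X _ _ "\<lambda>_. X"])
      (auto simp: sets_borel_on \<mu>.emeasure_eq_measure \<nu>.emeasure_eq_measure)
qed

subsection \<open>The weak* topology\<close>

lemma openin_weak_star_integral:
  fixes \<phi> :: "'a::topological_space \<Rightarrow> real"
  assumes "continuous_on X \<phi>" "open U"
  shows "openin (weak_star_topology X) {\<mu> \<in> prob_measures X. (\<integral>x. \<phi> x \<partial>\<mu>) \<in> U}"
  unfolding weak_star_topology_def using assms by (intro topology_generated_by_Basis) auto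

lemma topspace_weak_star_topology [simp]: "topspace (weak_star_topology X) = prob_measures X"
proof
  show "topspace (weak_star_topology X) \<subseteq> prob_measures X"
    unfolding weak_star_topology_def topology_generated_by_topspace by blast
  show "prob_measures X \<subseteq> topspace (weak_star_topology X)"
    using openin_subset[OF openin_weak_star_integral[of X "\<lambda>_. 0" UNIV]] by simp
qed

lemma continuous_map_weak_star_topology:
  assumes "\<And>x. x \<in> topspace T \<Longrightarrow> h x \<in> prob_measures X"
    and "\<And>\<phi>. continuous_on X \<phi> \<Longrightarrow> continuous_map T euclideanreal (\<lambda>x. \<integral>z. \<phi> z \<partial>h x)"
  shows "continuous_map T (weak_star_topology X) h"
  unfolding weak_star_topology_def
proof (rule continuous_on_generated_topo)
  let ?subbase = "{{\<mu> \<in> prob_measures X. (\<integral>z. \<phi> z \<partial>\<mu>) \<in> U} | \<phi> U.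
    continuous_on X (\<phi> :: _ \<Rightarrow> real) \<and> open U}"
  fix V assume "V \<in> ?subbase"
  then obtain \<phi> :: "'b \<Rightarrow> real" and U where V: "V = {\<mu> \<in> prob_measures X. (\<integral>z. \<phi> z \<partial>\<mu>) \<in> U}"
    "continuous_on X \<phi>" "open U" by blast
  have "h -` V \<inter> topspace T = {x \<in> topspace T. (\<integral>z. \<phi> z \<partial>h x) \<in> U}"
    using assms(1) by (auto simp: V(1))
  then show "openin T (h -` V \<inter> topspace T)"
    using assms(2)[OF V(2)] V(3) by (simp add: openin_continuous_map_preimage)
next
  have "topspace (weak_star_topology X) = prob_measures X" by simp
  then show "h ` topspace T \<subseteq> \<Union>{{\<mu> \<in> prob_measures X. (\<integral>z. \<phi> z \<partial>\<mu>) \<in> U} | \<phi> U.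
      continuous_on X (\<phi> :: _ \<Rightarrow> real) \<and> open U}"
    using assms(1) unfolding weak_star_topology_def topology_generated_by_topspace by blast
qed

definition weak_star_ball ::
  "'a::topological_space set \<Rightarrow> ('a \<Rightarrow> real) set \<Rightarrow> real \<Rightarrow> 'a measure \<Rightarrow> 'a measure set" where
  "weak_star_ball X F \<epsilon> \<mu> =
     {\<nu> \<in> prob_measures X. \<forall>\<phi>\<in>F. \<bar>(\<integral>x. \<phi> x \<partial>\<nu>) - (\<integral>x. \<phi> x \<partial>\<mu>)\<bar> < \<epsilon>}"

lemma weak_star_ball_mono:
  assumes "F \<subseteq> G" "\<delta> \<le> \<epsilon>"
  shows "weak_star_ball X G \<delta> \<mu> \<subseteq> weak_star_ball X F \<epsilon> \<mu>"
  using assms by (force simp: weak_star_ball_def)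

lemma weak_star_ball_triangle:
  assumes "\<nu> \<in> weak_star_ball X F \<epsilon> \<mu>"
  shows "weak_star_ball X F \<delta> \<nu> \<subseteq> weak_star_ball X F (\<epsilon> + \<delta>) \<mu>"
proof
  fix \<rho> assume \<rho>: "\<rho> \<in> weak_star_ball X F \<delta> \<nu>"
  have "\<bar>(\<integral>x. \<phi> x \<partial>\<rho>) - (\<integral>x. \<phi> x \<partial>\<mu>)\<bar> < \<epsilon> + \<delta>" if "\<phi> \<in> F" for \<phi>
  proof -
    have "\<bar>(\<integral>x. \<phi> x \<partial>\<nu>) - (\<integral>x. \<phi> x \<partial>\<mu>)\<bar> < \<epsilon>" "\<bar>(\<integral>x. \<phi> x \<partial>\<rho>) - (\<integral>x. \<phi> x \<partial>\<nu>)\<bar> < \<delta>"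
      using assms \<rho> that by (simp_all add: weak_star_ball_def)
    then show ?thesis by linarith
  qed
  then show "\<rho> \<in> weak_star_ball X F (\<epsilon> + \<delta>) \<mu>"
    using \<rho> by (simp add: weak_star_ball_def)
qed

lemma openin_weak_star_ball:
  assumes "finite F" "\<And>\<phi>. \<phi> \<in> F \<Longrightarrow> continuous_on X \<phi>"
  shows "openin (weak_star_topology X) (weak_star_ball X F \<epsilon> \<mu>)"
  using assms
proof (induction F rule: finite_induct)
  case empty
  then show ?case
    using openin_topspace[of "weak_star_topology X"] by (simp add: weak_star_ball_def)
next
  case (insert \<phi> F)
  have "weak_star_ball X (insert \<phi> F) \<epsilon> \<mu> =
      weak_star_ball X F \<epsilon> \<mu> \<inter> {\<nu> \<in> prob_measures X. (\<integral>x. \<phi> x \<partial>\<nu>) \<in> ball (\<integral>x. \<phi> x \<partial>\<mu>) \<epsilon>}"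
    by (auto simp: weak_star_ball_def dist_real_def abs_minus_commute)
  then show ?case
    using insert openin_weak_star_integral[of X \<phi> "ball (\<integral>x. \<phi> x \<partial>\<mu>) \<epsilon>"] by (auto intro: openin_Int)
qed

lemma ex_weak_star_ball_subset:
  fixes \<mu> :: "'a::topological_space measure"
  assumes "openin (weak_star_topology X) U" "\<mu> \<in> U"
  obtains F \<epsilon> where "finite F" "\<And>\<phi>. \<phi> \<in> F \<Longrightarrow> continuous_on X \<phi>" "\<epsilon> > 0"
    "weak_star_ball X F \<epsilon> \<mu> \<subseteq> U"
proof -
  have "generate_topology_on {{\<mu> \<in> prob_measures X. (\<integral>x. \<phi> x \<partial>\<mu>) \<in> U} | \<phi> U.
      continuous_on X (\<phi> :: 'a \<Rightarrow> real) \<and> open U} U"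
    using assms(1) unfolding weak_star_topology_def by (simp add: openin_topology_generated_by_iff)
  then have "\<exists>F \<epsilon>. finite F \<and> (\<forall>\<phi>\<in>F. continuous_on X \<phi>) \<and> \<epsilon> > 0 \<and> weak_star_ball X F \<epsilon> \<mu> \<subseteq> U"
    using assms(2)
  proof (induction rule: generate_topology_on.induct)
    case Empty
    then show ?case by simp
  next
    case (Int U V)
    then obtain F \<epsilon> G \<delta> where
      F: "finite F" "\<forall>\<phi>\<in>F. continuous_on X \<phi>" "\<epsilon> > 0" "weak_star_ball X F \<epsilon> \<mu> \<subseteq> U" and
      G: "finite G" "\<forall>\<phi>\<in>G. continuous_on X \<phi>" "\<delta> > 0" "weak_star_ball X G \<delta> \<mu> \<subseteq> V"
      by blast
    have "weak_star_ball X (F \<union> G) (min \<epsilon> \<delta>) \<mu> \<subseteq> U \<inter> V"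
      using F(4) G(4) weak_star_ball_mono[of F "F \<union> G" "min \<epsilon> \<delta>" \<epsilon> X \<mu>]
        weak_star_ball_mono[of G "F \<union> G" "min \<epsilon> \<delta>" \<delta> X \<mu>] by auto
    then show ?case using F G by (intro exI[of _ "F \<union> G"] exI[of _ "min \<epsilon> \<delta>"]) auto
  next
    case (UN K)
    then show ?case by (meson Sup_upper UnionE order_trans)
  next
    case (Basis V)
    then obtain \<phi> :: "'a \<Rightarrow> real" and S where V: "V = {\<mu> \<in> prob_measures X. (\<integral>x. \<phi> x \<partial>\<mu>) \<in> S}"
      and "continuous_on X \<phi>" "open S" by blast
    moreover have "(\<integral>x. \<phi> x \<partial>\<mu>) \<in> S" using Basis V by simp
    ultimately obtain \<epsilon> where "\<epsilon> > 0" "ball (\<integral>x. \<phi> x \<partial>\<mu>) \<epsilon> \<subseteq> S"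
      using open_contains_ball by blast
    then have "weak_star_ball X {\<phi>} \<epsilon> \<mu> \<subseteq> V"
      by (auto simp: V weak_star_ball_def dist_real_def abs_minus_commute subset_iff)
    then show ?case
      using \<open>\<epsilon> > 0\<close> \<open>continuous_on X \<phi>\<close> by (intro exI[of _ "{\<phi>}"] exI[of _ \<epsilon>]) simp
  qed
  then show ?thesis using that by blast
qed

lemma ex_double_weak_star_ball_in_cover:
  fixes X :: "'a::topological_space set"
  assumes \<U>: "\<U> \<in> open_covers (weak_star_topology X)" and \<mu>: "\<mu> \<in> prob_measures X"
  shows "\<exists>F \<epsilon>. finite F \<and> (\<forall>\<phi>\<in>F. continuous_on X \<phi>) \<and> \<epsilon> > 0 \<and>
    (\<exists>U\<in>\<U>. weak_star_ball X F (2 * \<epsilon>) \<mu> \<subseteq> U)"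
proof -
  have "\<mu> \<in> \<Union>\<U>" using \<mu> \<U> by (simp add: open_covers_def)
  then obtain U where U: "U \<in> \<U>" "\<mu> \<in> U" by blast
  then have U_open: "openin (weak_star_topology X) U" using \<U> by (simp add: open_covers_def)
  obtain F \<epsilon> where "finite F" "\<forall>\<phi>\<in>F. continuous_on X \<phi>" "\<epsilon> > 0" "weak_star_ball X F \<epsilon> \<mu> \<subseteq> U"
    using ex_weak_star_ball_subset[OF U_open U(2)] by metis
  then show ?thesis using U(1) by (intro exI[of _ F] exI[of _ "\<epsilon> / 2"]) auto
qed

lemma weak_star_Lebesgue_number:
  fixes X :: "'a::topological_space set"
  assumes "compact_space (weak_star_topology X)" and \<U>: "\<U> \<in> open_covers (weak_star_topology X)"
  obtains F \<epsilon> where "finite F" "\<And>\<phi>. \<phi> \<in> F \<Longrightarrow> continuous_on X \<phi>" "\<epsilon> > 0"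
    "\<And>\<mu>. \<mu> \<in> prob_measures X \<Longrightarrow> \<exists>U\<in>\<U>. weak_star_ball X F \<epsilon> \<mu> \<subseteq> U"
proof -
  obtain F \<epsilon> where F: "\<And>\<mu>. \<mu> \<in> prob_measures X \<Longrightarrow> finite (F \<mu>)"
      "\<And>\<mu> \<phi>. \<mu> \<in> prob_measures X \<Longrightarrow> \<phi> \<in> F \<mu> \<Longrightarrow> continuous_on X \<phi>"
      "\<And>\<mu>. \<mu> \<in> prob_measures X \<Longrightarrow> \<epsilon> \<mu> > 0"
      "\<And>\<mu>. \<mu> \<in> prob_measures X \<Longrightarrow> \<exists>U\<in>\<U>. weak_star_ball X (F \<mu>) (2 * \<epsilon> \<mu>) \<mu> \<subseteq> U"
    using ex_double_weak_star_ball_in_cover[OF \<U>] by metis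
  define W where "W \<mu> = weak_star_ball X (F \<mu>) (\<epsilon> \<mu>) \<mu>" for \<mu>
  have "openin (weak_star_topology X) V" if "V \<in> W ` prob_measures X" for V
    using that F by (auto simp: W_def intro!: openin_weak_star_ball)
  moreover have "prob_measures X \<subseteq> \<Union>(W ` prob_measures X)"
    using F(3) by (auto simp: W_def weak_star_ball_def)
  ultimately obtain \<D> where "finite \<D>" "\<D> \<subseteq> W ` prob_measures X" "prob_measures X \<subseteq> \<Union>\<D>"
    using assms(1) unfolding compact_space_alt topspace_weak_star_topology by meson
  then obtain D where D: "finite D" "D \<subseteq> prob_measures X" "prob_measures X \<subseteq> (\<Union>\<mu>\<in>D. W \<mu>)"
    using finite_subset_image[of \<D> W "prob_measures X"] by blast
  define \<delta> where "\<delta> = Min (insert 1 (\<epsilon> ` D))"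
  show ?thesis
  proof (rule that[of "\<Union>\<mu>\<in>D. F \<mu>" \<delta>])
    show "finite (\<Union>\<mu>\<in>D. F \<mu>)" using D F(1) by blast
    show "continuous_on X \<phi>" if "\<phi> \<in> (\<Union>\<mu>\<in>D. F \<mu>)" for \<phi> using that D(2) F(2) by blast
    show "\<delta> > 0" using D(1,2) F(3) by (auto simp: \<delta>_def)
    fix \<nu> assume "\<nu> \<in> prob_measures X"
    then obtain \<mu> where \<mu>: "\<mu> \<in> D" "\<nu> \<in> W \<mu>" using D(3) by blast
    have "weak_star_ball X (\<Union>\<mu>\<in>D. F \<mu>) \<delta> \<nu> \<subseteq> weak_star_ball X (F \<mu>) (\<epsilon> \<mu>) \<nu>"
      using \<mu>(1) D(1) by (intro weak_star_ball_mono) (auto simp: \<delta>_def)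
    also have "\<dots> \<subseteq> weak_star_ball X (F \<mu>) (2 * \<epsilon> \<mu>) \<mu>"
      using weak_star_ball_triangle[OF \<mu>(2)[unfolded W_def], of "\<epsilon> \<mu>"] by simp
    finally show "\<exists>U\<in>\<U>. weak_star_ball X (\<Union>\<mu>\<in>D. F \<mu>) \<delta> \<nu> \<subseteq> U"
      using F(4)[of \<mu>] \<mu>(1) D(2) by (meson order_trans subsetD)
  qed
qed

subsection \<open>Compactness of the space of measures\<close>

text \<open>A sequence of Borel sets \<open>B\<close> separating points at every scale codes \<open>X\<close> by binary
  sequences. A measure is determined by the masses of its cells, and conversely consistent
  masses \<open>p\<close> come from a measure: cut \<open>[0,1)\<close> into nested intervals of lengths \<open>p s\<close> and
  send \<open>t\<close> to the limit of points in the cells whose intervals contain \<open>t\<close>. Thus the space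
  of measures is a continuous image of a closed subset of a compact product of unit intervals.\<close>

abbreviation words :: "nat \<Rightarrow> bool list set" where
  "words k \<equiv> {s. length s = k}"

lemma finite_words: "finite (words k)"
  using finite_lists_length_eq[of "UNIV :: bool set" k] by simp

lemma (in prob_space) expectation_finite_valued_approx:
  fixes Y :: "'a \<Rightarrow> real"
  assumes "finite S" and D: "D \<in> measurable M (count_space S)" and Y: "Y \<in> borel_measurable M"
    and close: "\<And>t. t \<in> space M \<Longrightarrow> \<bar>Y t - v (D t)\<bar> \<le> \<eta>"
  shows "\<bar>expectation Y - (\<Sum>s\<in>S. prob {t \<in> space M. D t = s} * v s)\<bar> \<le> \<eta>"
proof -
  let ?fibre = "\<lambda>s. {t \<in> space M. D t = s}"
  define Z where "Z t = (\<Sum>s\<in>S. indicator (?fibre s) t * v s)" for t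
  have fibre: "?fibre s \<in> events" if "s \<in> S" for s
    using measurable_sets[OF D, of "{s}"] that by (simp add: vimage_def Int_def conj_commute)
  have Z_int: "integrable M Z"
    unfolding Z_def using fibre
    by (intro Bochner_Integration.integrable_sum) (auto simp: emeasure_eq_measure)
  have Z_expectation: "expectation Z = (\<Sum>s\<in>S. prob (?fibre s) * v s)"
    unfolding Z_def using fibre
    by (subst Bochner_Integration.integral_sum) (auto simp: emeasure_eq_measure Int_absorb1)
  have Z_eq: "Z t = v (D t)" if "t \<in> space M" for t
  proof -
    have "Z t = (\<Sum>s\<in>S. if s = D t then v s else 0)"
      unfolding Z_def using that by (intro sum.cong) (auto simp: indicator_def)
    also have "\<dots> = v (D t)"
      using \<open>finite S\<close> measurable_space[OF D that] by simp
    finally show ?thesis .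
  qed
  have diff_int: "integrable M (\<lambda>t. Y t - Z t)"
    using Y Z_int close Z_eq by (intro integrable_const_bound[of _ \<eta>]) auto
  have "\<bar>expectation (\<lambda>t. Y t - Z t)\<bar> \<le> expectation (\<lambda>t. \<bar>Y t - Z t\<bar>)"
    by (rule integral_abs_bound)
  also have "\<dots> \<le> expectation (\<lambda>t. \<eta>)"
    using diff_int close Z_eq by (intro integral_mono) auto
  finally have "\<bar>expectation (\<lambda>t. Y t - Z t)\<bar> \<le> \<eta>" by (simp add: prob_space)
  moreover have "expectation Y = expectation (\<lambda>t. Y t - Z t) + expectation Z"
    using Bochner_Integration.integral_add[OF diff_int Z_int] by simp
  ultimately show ?thesis by (simp add: Z_expectation)
qed

definition unit_uniform :: "real measure" where
  "unit_uniform = restrict_space lborel {0..<1}"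

lemma space_unit_uniform [simp]: "space unit_uniform = {0..<1}"
  by (simp add: unit_uniform_def space_restrict_space)

lemma prob_space_unit_uniform: "prob_space unit_uniform"
  unfolding unit_uniform_def by (rule prob_space_restrict_space) simp_all

locale binary_coding =
  fixes X :: "'a::metric_space set" and B :: "nat \<Rightarrow> 'a set"
  assumes compact_X: "compact X"
    and B_borel: "\<And>i. B i \<in> sets borel"
    and B_small: "\<And>e. e > 0 \<Longrightarrow> \<exists>m. \<forall>x\<in>X. \<exists>i<m. x \<in> B i \<and> (\<forall>y\<in>B i. dist x y < e)"
begin

text \<open>Codes are stored with the most recent bit first.\<close>

primrec cell :: "bool list \<Rightarrow> 'a set" where
  "cell [] = X"
| "cell (b # s) = {x \<in> cell s. (x \<in> B (length s)) = b}"

primrec code :: "'a \<Rightarrow> nat \<Rightarrow> bool list" where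
  "code x 0 = []"
| "code x (Suc k) = (x \<in> B k) # code x k"

lemma length_code [simp]: "length (code x k) = k"
  by (induction k) auto

lemma mem_cell_iff: "x \<in> cell s \<longleftrightarrow> x \<in> X \<and> code x (length s) = s"
  by (induction s) auto

lemma mem_B_cong_code: "code x k = code y k \<Longrightarrow> i < k \<Longrightarrow> x \<in> B i \<longleftrightarrow> y \<in> B i"
  by (induction k) (auto simp: less_Suc_eq)

lemma cell_subset: "cell s \<subseteq> X"
  by (auto simp: mem_cell_iff)

lemma sets_cell: "cell s \<in> sets (borel_on X)"
proof (induction s)
  case Nil
  then show ?case using sets.top[of "borel_on X"] by simp
next
  case (Cons b s)
  have "X \<inter> B (length s) \<in> sets (borel_on X)"
    using B_borel by (auto simp: sets_restrict_space)
  moreover have "cell (b # s) =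
      (if b then cell s \<inter> (X \<inter> B (length s)) else cell s - (X \<inter> B (length s)))"
    using cell_subset[of s] by auto
  ultimately show ?case using Cons by auto
qed

lemma eventually_cell_small:
  assumes "e > 0"
  shows "\<forall>\<^sub>F k in sequentially. \<forall>s\<in>words k. \<forall>x\<in>cell s. \<forall>y\<in>cell s. dist x y < e"
proof -
  obtain m where m: "\<forall>x\<in>X. \<exists>i<m. x \<in> B i \<and> (\<forall>y\<in>B i. dist x y < e)"
    using B_small[OF assms] by auto
  show ?thesis
    using eventually_ge_at_top[of m]
  proof eventually_elim
    case (elim k)
    have "dist x y < e" if s: "s \<in> words k" "x \<in> cell s" "y \<in> cell s" for s x y
    proof -
      obtain i where i: "i < m" "x \<in> B i" "\<forall>y\<in>B i. dist x y < e"
        using m s by (auto simp: mem_cell_iff)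
      have "code x k = code y k" using s by (auto simp: mem_cell_iff)
      then have "y \<in> B i" using mem_B_cong_code[of x k y i] i elim by simp
      then show ?thesis using i(3) by simp
    qed
    then show ?case by blast
  qed
qed

definition cell_point :: "bool list \<Rightarrow> 'a" where
  "cell_point s = (SOME x. x \<in> cell s)"

lemma cell_point_in: "cell s \<noteq> {} \<Longrightarrow> cell_point s \<in> cell s"
  unfolding cell_point_def using some_in_eq by blast

lemma eventually_cell_oscillation_le:
  fixes \<phi> :: "'a \<Rightarrow> real"
  assumes "continuous_on X \<phi>" "\<eta> > 0"
  shows "\<forall>\<^sub>F k in sequentially. \<forall>s\<in>words k. cell s \<noteq> {} \<longrightarrow>
    (\<forall>x\<in>X \<inter> closure (cell s). \<bar>\<phi> x - \<phi> (cell_point s)\<bar> \<le> \<eta>)"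
proof -
  obtain d where d: "d > 0" "\<And>x y. x \<in> X \<Longrightarrow> y \<in> X \<Longrightarrow> dist y x < d \<Longrightarrow> dist (\<phi> y) (\<phi> x) < \<eta>"
    using compact_uniformly_continuous[OF assms(1) compact_X] assms(2)
    unfolding uniformly_continuous_on_def by metis
  have "\<forall>\<^sub>F k in sequentially. \<forall>s\<in>words k. \<forall>x\<in>cell s. \<forall>y\<in>cell s. dist x y < d / 2"
    using d(1) by (intro eventually_cell_small) simp
  then show ?thesis
  proof eventually_elim
    case (elim k)
    have "\<bar>\<phi> x - \<phi> (cell_point s)\<bar> \<le> \<eta>"
      if s: "s \<in> words k" "cell s \<noteq> {}" and x: "x \<in> X" "x \<in> closure (cell s)" for s x
    proof -
      have "cell s \<subseteq> cball (cell_point s) (d / 2)"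
        using elim s(1) cell_point_in[OF s(2)] by (force simp del: le_divide_eq_numeral1)
      then have "closure (cell s) \<subseteq> cball (cell_point s) (d / 2)"
        by (intro closure_minimal) auto
      then have "dist x (cell_point s) < d" using x(2) d(1) by (auto simp: dist_commute)
      moreover have "cell_point s \<in> X" using cell_point_in[OF s(2)] cell_subset by blast
      ultimately have "dist (\<phi> x) (\<phi> (cell_point s)) < \<eta>" using d(2) x(1) by blast
      then show ?thesis by (simp add: dist_real_def)
    qed
    then show ?case by blast
  qed
qed

definition consistent_masses :: "(bool list \<Rightarrow> real) set" where
  "consistent_masses = {p. p [] = 1 \<and> (\<forall>s. 0 \<le> p s \<and> p s \<le> 1) \<and>
     (\<forall>s. p s = p (False # s) + p (True # s)) \<and> (\<forall>s. cell s = {} \<longrightarrow> p s = 0)}"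

lemma consistent_massesD:
  assumes "p \<in> consistent_masses"
  shows "p [] = 1" "0 \<le> p s" "p s \<le> 1" "p s = p (False # s) + p (True # s)"
    "cell s = {} \<Longrightarrow> p s = 0"
  using assms unfolding consistent_masses_def by blast+

lemma compact_consistent_masses: "compact consistent_masses"
proof -
  let ?cube = "UNIV \<rightarrow>\<^sub>E {0..1} :: (bool list \<Rightarrow> real) set"
  have "compactin (product_topology (\<lambda>_. euclidean) UNIV) ?cube"
    by (simp add: compactin_PiE)
  then have "compact ?cube" by (simp add: euclidean_product_topology)
  moreover have "closed consistent_masses"
    unfolding consistent_masses_def
    by (intro closed_Collect_conj closed_Collect_all closed_Collect_imp closed_Collect_eq
        closed_Collect_le open_Collect_const continuous_on_add continuous_on_const
        continuous_on_product_coordinates)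
  moreover have "consistent_masses = ?cube \<inter> consistent_masses"
    using consistent_massesD(2,3) by (force simp: PiE_UNIV_domain Pi_iff)
  ultimately show ?thesis using compact_Int_closed by metis
qed

primrec interval_start :: "(bool list \<Rightarrow> real) \<Rightarrow> bool list \<Rightarrow> real" where
  "interval_start p [] = 0"
| "interval_start p (b # s) = interval_start p s + (if b then p (False # s) else 0)"

primrec interval_code :: "(bool list \<Rightarrow> real) \<Rightarrow> real \<Rightarrow> nat \<Rightarrow> bool list" where
  "interval_code p t 0 = []"
| "interval_code p t (Suc k) =
     (let s = interval_code p t k in (interval_start p s + p (False # s) \<le> t) # s)"

lemma length_interval_code [simp]: "length (interval_code p t k) = k"
  by (induction k) (auto simp: Let_def)

lemma interval_code_eq_iff:
  assumes p: "p \<in> consistent_masses" and "t \<in> {0..<1}"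
  shows "interval_code p t (length s) = s \<longleftrightarrow> t \<in> {interval_start p s..<interval_start p s + p s}"
proof (induction s)
  case Nil
  then show ?case using assms(2) consistent_massesD(1)[OF p] by auto
next
  case (Cons b s)
  have "interval_code p t (length (b # s)) = b # s \<longleftrightarrow>
      interval_code p t (length s) = s \<and> (interval_start p s + p (False # s) \<le> t) = b"
    by (auto simp: Let_def)
  also have "\<dots> \<longleftrightarrow> t \<in> {interval_start p (b # s)..<interval_start p (b # s) + p (b # s)}"
    unfolding Cons
    using consistent_massesD(4)[OF p, of s] consistent_massesD(2)[OF p, of "True # s"]
      consistent_massesD(2)[OF p, of "False # s"]
    by (cases b) auto
  finally show ?case .
qed

lemma interval_subset_unit:
  assumes p: "p \<in> consistent_masses"
  shows "0 \<le> interval_start p s \<and> interval_start p s + p s \<le> 1"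
proof (induction s)
  case Nil
  then show ?case using consistent_massesD(1)[OF p] by simp
next
  case (Cons b s)
  then show ?case
    using consistent_massesD(4)[OF p, of s] consistent_massesD(2)[OF p, of "True # s"]
      consistent_massesD(2)[OF p, of "False # s"]
    by auto
qed

lemma cell_interval_code_nonempty:
  assumes p: "p \<in> consistent_masses" and t: "t \<in> {0..<1}"
  shows "cell (interval_code p t k) \<noteq> {}"
  using interval_code_eq_iff[OF p t, of "interval_code p t k"]
    consistent_massesD(5)[OF p, of "interval_code p t k"] by auto

lemma cell_interval_code_antimono:
  "j \<le> k \<Longrightarrow> cell (interval_code p t k) \<subseteq> cell (interval_code p t j)"
  by (induction k rule: dec_induct) (auto simp: Let_def)

lemma interval_code_fibre:
  assumes "p \<in> consistent_masses" "s \<in> words k"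
  shows "{t \<in> space unit_uniform. interval_code p t k = s} =
    {interval_start p s..<interval_start p s + p s}"
  using interval_code_eq_iff[OF assms(1), of _ s] interval_subset_unit[OF assms(1), of s] assms(2)
  by auto

lemma measurable_interval_code:
  assumes p: "p \<in> consistent_masses"
  shows "(\<lambda>t. interval_code p t k) \<in> measurable unit_uniform (count_space (words k))"
proof -
  have "(\<lambda>t. interval_code p t k) -` {s} \<inter> space unit_uniform \<in> sets unit_uniform"
    if "s \<in> words k" for s
  proof -
    have "(\<lambda>t. interval_code p t k) -` {s} \<inter> space unit_uniform =
        {t \<in> space unit_uniform. interval_code p t k = s}"
      by auto
    also have "\<dots> = {interval_start p s..<interval_start p s + p s}"
      by (rule interval_code_fibre[OF p that])
    also have "\<dots> \<in> sets unit_uniform"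
      using interval_subset_unit[OF p, of s]
      by (auto simp: unit_uniform_def sets_restrict_space_iff)
    finally show ?thesis .
  qed
  then show ?thesis by (subst measurable_count_space_eq2[OF finite_words]) auto
qed

lemma measure_interval_code_fibre:
  assumes p: "p \<in> consistent_masses" and s: "s \<in> words k"
  shows "measure unit_uniform {t \<in> space unit_uniform. interval_code p t k = s} = p s"
  unfolding interval_code_fibre[OF assms]
  using consistent_massesD(2)[OF p, of s] interval_subset_unit[OF p, of s]
  by (auto simp: unit_uniform_def measure_restrict_space)

definition coded_point :: "(bool list \<Rightarrow> real) \<Rightarrow> real \<Rightarrow> 'a" where
  "coded_point p t = lim (\<lambda>k. cell_point (interval_code p t k))"

lemma
  assumes p: "p \<in> consistent_masses" and t: "t \<in> {0..<1}"
  shows coded_point_tendsto: "(\<lambda>k. cell_point (interval_code p t k)) \<longlonglongrightarrow> coded_point p t"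
      (is "?y \<longlonglongrightarrow> _")
    and coded_point_in: "coded_point p t \<in> X \<inter> closure (cell (interval_code p t k))"
proof -
  have in_cell: "?y k \<in> cell (interval_code p t j)" if "j \<le> k" for j k
    using cell_point_in[OF cell_interval_code_nonempty[OF p t]] cell_interval_code_antimono[OF that]
    by blast
  have "Cauchy ?y"
  proof (rule metric_CauchyI)
    fix e :: real assume "e > 0"
    then obtain m where m: "\<forall>s\<in>words m. \<forall>x\<in>cell s. \<forall>y\<in>cell s. dist x y < e"
      using eventually_happens'[OF sequentially_bot eventually_cell_small[OF \<open>e > 0\<close>]] by blast
    then show "\<exists>M. \<forall>i\<ge>M. \<forall>j\<ge>M. dist (?y i) (?y j) < e"
      using m[rule_format, of "interval_code p t m"] in_cell by (intro exI[of _ m]) simp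
  qed
  moreover have "?y k \<in> X" for k using in_cell cell_subset by blast
  ultimately obtain l where l: "l \<in> X" "?y \<longlonglongrightarrow> l"
    using compact_imp_complete[OF compact_X, unfolded complete_def, rule_format, of ?y] by auto
  then have coded_point_eq: "coded_point p t = l" unfolding coded_point_def by (intro limI)
  show "?y \<longlonglongrightarrow> coded_point p t" using l coded_point_eq by simp
  have "\<forall>\<^sub>F j in sequentially. ?y j \<in> closure (cell (interval_code p t k))"
    using eventually_ge_at_top[of k] by eventually_elim (meson in_cell closure_subset subsetD)
  then show "coded_point p t \<in> X \<inter> closure (cell (interval_code p t k))"
    using l Lim_in_closed_set[OF closed_closure _ _ l(2)] by (simp add: coded_point_eq)
qed

lemma measurable_coded_point:
  assumes p: "p \<in> consistent_masses"
  shows "coded_point p \<in> measurable unit_uniform (borel_on X)"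
proof (rule measurable_restrict_space2)
  show "coded_point p \<in> space unit_uniform \<rightarrow> X" using coded_point_in[OF p] by auto
  show "coded_point p \<in> borel_measurable unit_uniform"
  proof (rule borel_measurable_LIMSEQ_metric)
    show "(\<lambda>t. cell_point (interval_code p t k)) \<in> borel_measurable unit_uniform" for k
      using measurable_compose[OF measurable_interval_code[OF p, of k], of cell_point borel] by simp
    show "(\<lambda>k. cell_point (interval_code p t k)) \<longlonglongrightarrow> coded_point p t"
      if "t \<in> space unit_uniform" for t
      using coded_point_tendsto[OF p] that by simp
  qed
qed

definition measure_of_masses :: "(bool list \<Rightarrow> real) \<Rightarrow> 'a measure" where
  "measure_of_masses p = distr unit_uniform (borel_on X) (coded_point p)"

lemma measure_of_masses_in: "p \<in> consistent_masses \<Longrightarrow> measure_of_masses p \<in> prob_measures X"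
  unfolding measure_of_masses_def
  by (intro distr_in_prob_measures prob_space_unit_uniform measurable_coded_point)

definition cell_masses :: "'a measure \<Rightarrow> bool list \<Rightarrow> real" where
  "cell_masses \<mu> s = measure \<mu> (cell s)"

lemma cell_masses_consistent:
  assumes \<mu>: "\<mu> \<in> prob_measures X"
  shows "cell_masses \<mu> \<in> consistent_masses"
proof -
  interpret prob_space \<mu> using \<mu> by (rule prob_measuresD)
  have events: "cell s \<in> events" for s using sets_cell prob_measuresD(2)[OF \<mu>] by simp
  have additive: "prob (cell s) = prob (cell (False # s)) + prob (cell (True # s))" for s
    by (subst finite_measure_Union[symmetric, OF events events])
      (auto intro!: arg_cong[where f = prob])
  show ?thesis
    unfolding consistent_masses_def cell_masses_def mem_Collect_eq
  proof (intro conjI allI impI)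
    show "prob (cell []) = 1" using prob_space prob_measuresD(3)[OF \<mu>] by simp
  qed (fact additive | simp)+
qed

definition cell_sum :: "('a \<Rightarrow> real) \<Rightarrow> nat \<Rightarrow> (bool list \<Rightarrow> real) \<Rightarrow> real" where
  "cell_sum \<phi> k p = (\<Sum>s\<in>words k. p s * \<phi> (cell_point s))"

lemma uniform_limit_cell_sum:
  fixes \<phi> :: "'a \<Rightarrow> real"
  assumes \<phi>: "continuous_on X \<phi>"
  shows "uniform_limit consistent_masses (cell_sum \<phi>)
    (\<lambda>p. \<integral>x. \<phi> x \<partial>measure_of_masses p) sequentially"
proof (rule uniform_limitI)
  fix e :: real assume "e > 0"
  then have "\<forall>\<^sub>F k in sequentially. \<forall>s\<in>words k. cell s \<noteq> {} \<longrightarrow>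
      (\<forall>x\<in>X \<inter> closure (cell s). \<bar>\<phi> x - \<phi> (cell_point s)\<bar> \<le> e / 2)"
    by (intro eventually_cell_oscillation_le \<phi>) simp
  then show "\<forall>\<^sub>F k in sequentially. \<forall>p\<in>consistent_masses.
      dist (cell_sum \<phi> k p) (\<integral>x. \<phi> x \<partial>measure_of_masses p) < e"
  proof (eventually_elim, intro ballI)
    fix k p
    assume osc: "\<forall>s\<in>words k. cell s \<noteq> {} \<longrightarrow>
        (\<forall>x\<in>X \<inter> closure (cell s). \<bar>\<phi> x - \<phi> (cell_point s)\<bar> \<le> e / 2)"
      and p: "p \<in> consistent_masses"
    interpret prob_space unit_uniform by (rule prob_space_unit_uniform)
    have \<phi>_meas: "\<phi> \<in> borel_measurable (borel_on X)"
      using \<phi> by (rule borel_measurable_continuous_on_restrict)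
    have "\<bar>expectation (\<lambda>t. \<phi> (coded_point p t)) - (\<Sum>s\<in>words k.
        prob {t \<in> space unit_uniform. interval_code p t k = s} * \<phi> (cell_point s))\<bar> \<le> e / 2"
      using osc cell_interval_code_nonempty[OF p] coded_point_in[OF p]
        measurable_compose[OF measurable_coded_point[OF p] \<phi>_meas]
      by (intro expectation_finite_valued_approx finite_words measurable_interval_code p) auto
    moreover have "(\<Sum>s\<in>words k. prob {t \<in> space unit_uniform. interval_code p t k = s} *
        \<phi> (cell_point s)) = cell_sum \<phi> k p"
      unfolding cell_sum_def by (intro sum.cong) (simp_all only: measure_interval_code_fibre[OF p])
    moreover have "(\<integral>x. \<phi> x \<partial>measure_of_masses p) = expectation (\<lambda>t. \<phi> (coded_point p t))"
      unfolding measure_of_masses_def by (intro integral_distr measurable_coded_point p \<phi>_meas)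
    ultimately show "dist (cell_sum \<phi> k p) (\<integral>x. \<phi> x \<partial>measure_of_masses p) < e"
      using \<open>e > 0\<close> unfolding dist_real_def by linarith
  qed
qed

lemma continuous_on_integral_measure_of_masses:
  fixes \<phi> :: "'a \<Rightarrow> real"
  assumes "continuous_on X \<phi>"
  shows "continuous_on consistent_masses (\<lambda>p. \<integral>x. \<phi> x \<partial>measure_of_masses p)"
proof (rule uniform_limit_theorem[OF _ uniform_limit_cell_sum[OF assms]])
  show "\<forall>\<^sub>F k in sequentially. continuous_on consistent_masses (cell_sum \<phi> k)"
    unfolding cell_sum_def
    by (intro always_eventually allI continuous_on_sum continuous_on_mult_right
        continuous_on_subset[OF continuous_on_product_coordinates] subset_UNIV)
qed simp

lemma cell_sum_cell_masses_tendsto: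
  assumes \<mu>: "\<mu> \<in> prob_measures X" and \<phi>: "continuous_on X \<phi>"
  shows "(\<lambda>k. cell_sum \<phi> k (cell_masses \<mu>)) \<longlonglongrightarrow> (\<integral>x. \<phi> x \<partial>\<mu>)"
proof (rule metric_LIMSEQ_I)
  interpret prob_space \<mu> using \<mu> by (rule prob_measuresD)
  have space: "space \<mu> = X" using \<mu> by (rule prob_measuresD)
  have fibre: "{x \<in> space \<mu>. code x k = s} = cell s" if "s \<in> words k" for k s
    using that by (auto simp: space mem_cell_iff)
  have code_meas: "(\<lambda>x. code x k) \<in> measurable \<mu> (count_space (words k))" for k
  proof -
    have "(\<lambda>x. code x k) -` {s} \<inter> space \<mu> \<in> events" if "s \<in> words k" for s
    proof -
      have "(\<lambda>x. code x k) -` {s} \<inter> space \<mu> = cell s" using fibre[OF that] by auto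
      then show ?thesis using sets_cell prob_measuresD(2)[OF \<mu>] by simp
    qed
    then show ?thesis by (subst measurable_count_space_eq2[OF finite_words]) auto
  qed
  fix e :: real assume "e > 0"
  then have "\<forall>\<^sub>F k in sequentially. \<forall>s\<in>words k. cell s \<noteq> {} \<longrightarrow>
      (\<forall>x\<in>X \<inter> closure (cell s). \<bar>\<phi> x - \<phi> (cell_point s)\<bar> \<le> e / 2)"
    by (intro eventually_cell_oscillation_le \<phi>) simp
  then have "\<forall>\<^sub>F k in sequentially. dist (cell_sum \<phi> k (cell_masses \<mu>)) (\<integral>x. \<phi> x \<partial>\<mu>) < e"
  proof eventually_elim
    case (elim k)
    have "\<bar>\<phi> x - \<phi> (cell_point (code x k))\<bar> \<le> e / 2" if "x \<in> space \<mu>" for x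
    proof -
      have "x \<in> cell (code x k)" "x \<in> X" using that by (auto simp: space mem_cell_iff)
      then show ?thesis
        using elim[rule_format, of "code x k" x] closure_subset[of "cell (code x k)"] by auto
    qed
    then have "\<bar>(\<integral>x. \<phi> x \<partial>\<mu>) -
        (\<Sum>s\<in>words k. prob {x \<in> space \<mu>. code x k = s} * \<phi> (cell_point s))\<bar> \<le> e / 2"
      using \<mu> \<phi>
      by (intro expectation_finite_valued_approx finite_words code_meas
          borel_measurable_prob_measures)
    moreover have "(\<Sum>s\<in>words k. prob {x \<in> space \<mu>. code x k = s} * \<phi> (cell_point s)) =
        cell_sum \<phi> k (cell_masses \<mu>)"
      unfolding cell_sum_def cell_masses_def by (intro sum.cong) (simp_all only: fibre)
    ultimately show ?case using \<open>e > 0\<close> unfolding dist_real_def by linarith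
  qed
  then show "\<exists>N. \<forall>k\<ge>N. dist (cell_sum \<phi> k (cell_masses \<mu>)) (\<integral>x. \<phi> x \<partial>\<mu>) < e"
    by (simp add: eventually_sequentially)
qed

lemma measure_of_masses_cell_masses:
  assumes \<mu>: "\<mu> \<in> prob_measures X"
  shows "measure_of_masses (cell_masses \<mu>) = \<mu>"
proof (rule prob_measures_eqI[OF measure_of_masses_in[OF cell_masses_consistent[OF \<mu>]] \<mu>])
  fix \<phi> :: "'a \<Rightarrow> real" assume \<phi>: "continuous_on X \<phi>"
  have "(\<lambda>k. cell_sum \<phi> k (cell_masses \<mu>)) \<longlonglongrightarrow> (\<integral>x. \<phi> x \<partial>measure_of_masses (cell_masses \<mu>))"
    using uniform_limit_cell_sum[OF \<phi>] cell_masses_consistent[OF \<mu>] by (rule tendsto_uniform_limitI)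
  then show "(\<integral>x. \<phi> x \<partial>measure_of_masses (cell_masses \<mu>)) = (\<integral>x. \<phi> x \<partial>\<mu>)"
    using cell_sum_cell_masses_tendsto[OF \<mu> \<phi>] by (rule LIMSEQ_unique)
qed

lemma compact_space_prob_measures: "compact_space (weak_star_topology X)"
proof -
  have "continuous_map (top_of_set consistent_masses) (weak_star_topology X) measure_of_masses"
    by (intro continuous_map_weak_star_topology)
      (simp_all add: measure_of_masses_in continuous_on_integral_measure_of_masses)
  moreover have "compactin (top_of_set consistent_masses) consistent_masses"
    by (simp add: compactin_subtopology compact_consistent_masses)
  ultimately have "compactin (weak_star_topology X) (measure_of_masses ` consistent_masses)"
    by (rule image_compactin[rotated])
  moreover have "prob_measures X \<subseteq> measure_of_masses ` consistent_masses"
    by (metis cell_masses_consistent imageI measure_of_masses_cell_masses subsetI)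
  then have "measure_of_masses ` consistent_masses = prob_measures X"
    using measure_of_masses_in by blast
  ultimately show ?thesis by (simp add: compact_space_def)
qed

end

lemma compact_finite_ball_cover:
  fixes X :: "'a::metric_space set"
  assumes "compact X" "e > 0"
  shows "\<exists>(c :: nat \<Rightarrow> 'a) n. X \<subseteq> (\<Union>j<n. ball (c j) e)"
proof -
  obtain C where "finite C" "X \<subseteq> (\<Union>x\<in>C. ball x e)"
    using seq_compact_imp_totally_bounded[OF compact_imp_seq_compact[OF assms(1)]] assms(2) by blast
  moreover from \<open>finite C\<close> obtain c n where "C = c ` {i::nat. i < n}"
    by (auto simp: finite_conv_nat_seg_image)
  ultimately have "X \<subseteq> (\<Union>j<n. ball (c j) e)" by auto
  then show ?thesis by blast
qed

lemma ex_binary_coding: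
  fixes X :: "'a::metric_space set"
  assumes "compact X"
  shows "\<exists>B. binary_coding X B"
proof -
  let ?radius = "\<lambda>k. 1 / real (Suc k)"
  define covers where "covers k c n \<longleftrightarrow> X \<subseteq> (\<Union>j<n. ball (c j) (?radius k))"
    for k n and c :: "nat \<Rightarrow> 'a"
  have "\<exists>c n. covers k c n" for k
    unfolding covers_def by (rule compact_finite_ball_cover[OF assms]) simp
  then obtain c n where cover: "\<And>k. covers k (c k) (n k)" by metis
  define B where "B i = (case prod_decode i of (k, j) \<Rightarrow> ball (c k j) (?radius k))" for i
  have "\<exists>m. \<forall>x\<in>X. \<exists>i<m. x \<in> B i \<and> (\<forall>y\<in>B i. dist x y < e)" if "e > 0" for e
  proof -
    obtain k where k: "?radius k < e / 2"
      using nat_approx_posE[of "e / 2"] \<open>e > 0\<close> by (metis half_gt_zero)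
    obtain m where m: "\<And>j. j < n k \<Longrightarrow> prod_encode (k, j) < m"
      using finite_nat_set_iff_bounded[of "(\<lambda>j. prod_encode (k, j)) ` {..<n k}"] by auto
    have "\<exists>i<m. x \<in> B i \<and> (\<forall>y\<in>B i. dist x y < e)" if x: "x \<in> X" for x
    proof -
      obtain j where j: "j < n k" "x \<in> ball (c k j) (?radius k)"
        using cover[of k] x unfolding covers_def by blast
      have "dist x y < e" if "y \<in> ball (c k j) (?radius k)" for y
        using j(2) that k dist_triangle2[of x y "c k j"] by (simp add: dist_commute)
      then show ?thesis using m j by (intro exI[of _ "prod_encode (k, j)"]) (simp add: B_def)
    qed
    then show ?thesis by blast
  qed
  then have "binary_coding X B"
    using assms by unfold_locales (auto simp: B_def split: prod.split)
  then show ?thesis by blast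
qed

theorem compact_space_weak_star_topology:
  fixes X :: "'a::metric_space set"
  assumes "compact X"
  shows "compact_space (weak_star_topology X)"
  using ex_binary_coding[OF assms] binary_coding.compact_space_prob_measures by blast

subsection \<open>Approximation by averages of few points\<close>

lemma (in prob_space) ex_le_expectation:
  fixes Y :: "'a \<Rightarrow> real"
  assumes "integrable M Y"
  shows "\<exists>x\<in>space M. Y x \<le> expectation Y"
proof (rule ccontr)
  assume "\<not> ?thesis"
  then have "expectation Y < expectation Y"
    using assms by (intro expectation_greater) (auto simp: not_le)
  then show False by simp
qed

lemma (in prob_space) expectation_square_shifted_deviation:
  fixes Y :: "'a \<Rightarrow> real"
  assumes "integrable M Y" "integrable M (\<lambda>x. (Y x)\<^sup>2)"
  shows "integrable M (\<lambda>x. (s + (Y x - expectation Y))\<^sup>2)"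
    and "expectation (\<lambda>x. (s + (Y x - expectation Y))\<^sup>2) = s\<^sup>2 + variance Y"
proof -
  have sq: "integrable M (\<lambda>x. (Y x - expectation Y)\<^sup>2)"
    using assms by (simp add: power2_diff)
  have expand: "(\<lambda>x. (s + (Y x - expectation Y))\<^sup>2) =
      (\<lambda>x. s\<^sup>2 + 2 * s * (Y x - expectation Y) + (Y x - expectation Y)\<^sup>2)"
    by (intro ext) (simp add: power2_eq_square algebra_simps)
  show "integrable M (\<lambda>x. (s + (Y x - expectation Y))\<^sup>2)"
    unfolding expand using assms(1) sq by simp
  show "expectation (\<lambda>x. (s + (Y x - expectation Y))\<^sup>2) = s\<^sup>2 + variance Y"
    unfolding expand using assms(1) sq by (simp add: prob_space)
qed

text \<open>Maurey's argument: with error sums \<open>S\<close> after \<open>K\<close> points, the mean over the next point of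
  the squared norm of the new error sums exceeds that of \<open>S\<close> by the total variance only.\<close>

lemma (in prob_space) ex_points_error_le_variance:
  fixes \<psi> :: "'j \<Rightarrow> 'a \<Rightarrow> real"
  assumes int: "\<And>j. j \<in> J \<Longrightarrow> integrable M (\<psi> j)"
    and int_sq: "\<And>j. j \<in> J \<Longrightarrow> integrable M (\<lambda>x. (\<psi> j x)\<^sup>2)"
  shows "\<exists>y. (\<forall>l<K. y l \<in> space M) \<and>
    (\<Sum>j\<in>J. (\<Sum>l<K. \<psi> j (y l) - expectation (\<psi> j))\<^sup>2) \<le> real K * (\<Sum>j\<in>J. variance (\<psi> j))"
proof (induction K)
  case 0
  then show ?case by simp
next
  case (Suc K)
  then obtain y where y: "\<forall>l<K. y l \<in> space M"
    "(\<Sum>j\<in>J. (\<Sum>l<K. \<psi> j (y l) - expectation (\<psi> j))\<^sup>2) \<le> real K * (\<Sum>j\<in>J. variance (\<psi> j))"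
    by blast
  define S where "S j = (\<Sum>l<K. \<psi> j (y l) - expectation (\<psi> j))" for j
  define error where "error x = (\<Sum>j\<in>J. (S j + (\<psi> j x - expectation (\<psi> j)))\<^sup>2)" for x
  note shifted = expectation_square_shifted_deviation[OF int int_sq]
  have "integrable M error"
    unfolding error_def using shifted(1) by (intro Bochner_Integration.integrable_sum)
  then obtain z where z: "z \<in> space M" "error z \<le> expectation error"
    using ex_le_expectation by blast
  have "expectation error = (\<Sum>j\<in>J. expectation (\<lambda>x. (S j + (\<psi> j x - expectation (\<psi> j)))\<^sup>2))"
    unfolding error_def using shifted(1) by (intro Bochner_Integration.integral_sum)
  also have "\<dots> = (\<Sum>j\<in>J. (S j)\<^sup>2) + (\<Sum>j\<in>J. variance (\<psi> j))"
    using shifted(2) by (simp add: sum.distrib)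
  finally have mean_error: "expectation error = (\<Sum>j\<in>J. (S j)\<^sup>2) + (\<Sum>j\<in>J. variance (\<psi> j))" .
  have "(\<Sum>j\<in>J. (\<Sum>l<Suc K. \<psi> j ((y(K := z)) l) - expectation (\<psi> j))\<^sup>2) = error z"
    by (simp add: error_def S_def)
  also have "error z \<le> (\<Sum>j\<in>J. (S j)\<^sup>2) + (\<Sum>j\<in>J. variance (\<psi> j))"
    using z(2) mean_error by simp
  also have "\<dots> \<le> real (Suc K) * (\<Sum>j\<in>J. variance (\<psi> j))"
    using y(2) by (simp add: S_def algebra_simps)
  finally show ?case
    using y(1) z(1) by (intro exI[of _ "y(K := z)"]) (auto simp: less_Suc_eq)
qed

lemma (in prob_space) bounded_variable_moments:
  fixes Y :: "'a \<Rightarrow> real"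
  assumes "Y \<in> borel_measurable M" "\<And>x. x \<in> space M \<Longrightarrow> \<bar>Y x\<bar> \<le> b"
  shows "integrable M Y" "integrable M (\<lambda>x. (Y x)\<^sup>2)" "variance Y \<le> b\<^sup>2"
proof -
  have sq_le: "(Y x)\<^sup>2 \<le> b\<^sup>2" if "x \<in> space M" for x
    using assms(2)[OF that] abs_le_square_iff[of "Y x" b] by auto
  show int: "integrable M Y"
    using assms by (intro integrable_const_bound[of _ b]) auto
  show int_sq: "integrable M (\<lambda>x. (Y x)\<^sup>2)"
    using assms sq_le by (intro integrable_const_bound[of _ "b\<^sup>2"]) auto
  have "variance Y \<le> expectation (\<lambda>x. (Y x)\<^sup>2)"
    using int int_sq by (simp add: variance_eq)
  also have "\<dots> \<le> expectation (\<lambda>x. b\<^sup>2)"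
    using int_sq sq_le by (intro integral_mono) auto
  finally show "variance Y \<le> b\<^sup>2" by (simp add: prob_space)
qed

lemma (in prob_space) ex_points_error_le_bound:
  fixes \<psi> :: "'j \<Rightarrow> 'a \<Rightarrow> real"
  assumes meas: "\<And>j. j \<in> J \<Longrightarrow> \<psi> j \<in> borel_measurable M"
    and bound: "\<And>j x. j \<in> J \<Longrightarrow> x \<in> space M \<Longrightarrow> \<bar>\<psi> j x\<bar> \<le> b"
  shows "\<exists>y. (\<forall>l<K. y l \<in> space M) \<and>
    (\<Sum>j\<in>J. (\<Sum>l<K. \<psi> j (y l) - expectation (\<psi> j))\<^sup>2) \<le> real K * (real (card J) * b\<^sup>2)"
proof -
  note bounded = bounded_variable_moments[OF meas bound]
  obtain y where y: "\<forall>l<K. y l \<in> space M"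
    "(\<Sum>j\<in>J. (\<Sum>l<K. \<psi> j (y l) - expectation (\<psi> j))\<^sup>2) \<le> real K * (\<Sum>j\<in>J. variance (\<psi> j))"
    using ex_points_error_le_variance[of J \<psi> K] bounded(1,2) by blast
  have "(\<Sum>j\<in>J. variance (\<psi> j)) \<le> real (card J) * b\<^sup>2"
    using bounded(3) by (rule sum_bounded_above)
  then have "real K * (\<Sum>j\<in>J. variance (\<psi> j)) \<le> real K * (real (card J) * b\<^sup>2)"
    by (simp add: mult_left_mono)
  then show ?thesis using y order_trans by blast
qed

lemma card_ge_threshold_le_sum:
  fixes S :: "'i \<Rightarrow> real"
  assumes "finite I" "\<And>i. i \<in> I \<Longrightarrow> 0 \<le> S i"
  shows "real (card {i \<in> I. r \<le> S i}) * r \<le> (\<Sum>i\<in>I. S i)"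
proof -
  have "real (card {i \<in> I. r \<le> S i}) * r \<le> (\<Sum>i\<in>{i \<in> I. r \<le> S i}. S i)"
    using sum_bounded_below[of "{i \<in> I. r \<le> S i}" r S] by simp
  also have "\<dots> \<le> (\<Sum>i\<in>I. S i)" using assms by (intro sum_mono2) auto
  finally show ?thesis .
qed

lemma (in prob_space) ex_points_average_approx:
  fixes \<psi> :: "'i \<Rightarrow> 'f \<Rightarrow> 'a \<Rightarrow> real"
  assumes "finite I" "finite F" "0 < K" "0 < \<epsilon>"
    and meas: "\<And>i \<phi>. i \<in> I \<Longrightarrow> \<phi> \<in> F \<Longrightarrow> \<psi> i \<phi> \<in> borel_measurable M"
    and bound: "\<And>i \<phi> x. i \<in> I \<Longrightarrow> \<phi> \<in> F \<Longrightarrow> x \<in> space M \<Longrightarrow> \<bar>\<psi> i \<phi> x\<bar> \<le> b"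
  shows "\<exists>y. (\<forall>l<K. y l \<in> space M) \<and>
    real (card {i \<in> I. \<exists>\<phi>\<in>F. \<epsilon> \<le> \<bar>(\<Sum>l<K. \<psi> i \<phi> (y l)) / real K - expectation (\<psi> i \<phi>)\<bar>})
      \<le> real (card F) * b\<^sup>2 / (real K * \<epsilon>\<^sup>2) * real (card I)"
proof -
  define error where
    "error y i \<phi> = (\<Sum>l<K. \<psi> i \<phi> (y l) - expectation (\<psi> i \<phi>))" for y :: "nat \<Rightarrow> 'a" and i \<phi>
  have "\<exists>y. (\<forall>l<K. y l \<in> space M) \<and>
      (\<Sum>j\<in>I \<times> F. (\<Sum>l<K. case_prod \<psi> j (y l) - expectation (case_prod \<psi> j))\<^sup>2) \<le>
      real K * (real (card (I \<times> F)) * b\<^sup>2)"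
    using meas bound by (intro ex_points_error_le_bound) auto
  then obtain y where y: "\<forall>l<K. y l \<in> space M"
    "(\<Sum>(i, \<phi>)\<in>I \<times> F. (error y i \<phi>)\<^sup>2) \<le> real K * (real (card (I \<times> F)) * b\<^sup>2)"
    unfolding error_def split_beta by blast
  define S where "S i = (\<Sum>\<phi>\<in>F. (error y i \<phi>)\<^sup>2)" for i
  let ?bad = "{i \<in> I. \<exists>\<phi>\<in>F. \<epsilon> \<le> \<bar>(\<Sum>l<K. \<psi> i \<phi> (y l)) / real K - expectation (\<psi> i \<phi>)\<bar>}"
  have S_le: "(\<Sum>i\<in>I. S i) \<le> real K * (real (card I) * real (card F) * b\<^sup>2)"
    using y(2) by (simp add: S_def sum.cartesian_product card_cartesian_product)
  have "?bad \<subseteq> {i \<in> I. (real K * \<epsilon>)\<^sup>2 \<le> S i}"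
  proof clarify
    fix i \<phi> assume "i \<in> I" "\<phi> \<in> F"
      and far: "\<epsilon> \<le> \<bar>(\<Sum>l<K. \<psi> i \<phi> (y l)) / real K - expectation (\<psi> i \<phi>)\<bar>"
    have "error y i \<phi> = real K * ((\<Sum>l<K. \<psi> i \<phi> (y l)) / real K - expectation (\<psi> i \<phi>))"
      using \<open>0 < K\<close> by (simp add: error_def sum_subtractf right_diff_distrib)
    then have "real K * \<epsilon> \<le> \<bar>error y i \<phi>\<bar>" using far \<open>0 < K\<close> by (simp add: abs_mult)
    then have "(real K * \<epsilon>)\<^sup>2 \<le> (error y i \<phi>)\<^sup>2"
      using \<open>0 < \<epsilon>\<close> by (simp add: abs_le_square_iff[symmetric])
    also have "\<dots> \<le> S i"
      unfolding S_def using \<open>finite F\<close> \<open>\<phi> \<in> F\<close> by (intro member_le_sum) auto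
    finally show "(real K * \<epsilon>)\<^sup>2 \<le> S i" .
  qed
  then have "real (card ?bad) \<le> real (card {i \<in> I. (real K * \<epsilon>)\<^sup>2 \<le> S i})"
    using \<open>finite I\<close> by (simp add: card_mono)
  then have "real (card ?bad) * (real K * \<epsilon>)\<^sup>2 \<le>
      real (card {i \<in> I. (real K * \<epsilon>)\<^sup>2 \<le> S i}) * (real K * \<epsilon>)\<^sup>2"
    by (rule mult_right_mono) simp
  also have "\<dots> \<le> (\<Sum>i\<in>I. S i)"
    using \<open>finite I\<close> by (intro card_ge_threshold_le_sum) (simp_all add: S_def sum_nonneg)
  also note S_le
  finally have "real (card ?bad) \<le> real (card F) * b\<^sup>2 / (real K * \<epsilon>\<^sup>2) * real (card I)"
    using \<open>0 < K\<close> \<open>0 < \<epsilon>\<close> by (simp add: field_simps power2_eq_square)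
  then show ?thesis using y(1) by blast
qed

definition empirical_measure ::
  "'a::topological_space set \<Rightarrow> nat \<Rightarrow> (nat \<Rightarrow> 'a) \<Rightarrow> 'a measure" where
  "empirical_measure X K y = distr (uniform_count_measure {..<K}) (borel_on X) y"

lemma measurable_uniform_count_measure_borel_on:
  "y \<in> {..<K} \<rightarrow> X \<Longrightarrow> y \<in> measurable (uniform_count_measure {..<K}) (borel_on X)"
  by (auto simp: measurable_def space_uniform_count_measure sets_uniform_count_measure)

lemma empirical_measure_in:
  assumes "0 < K" "y \<in> {..<K} \<rightarrow> X"
  shows "empirical_measure X K y \<in> prob_measures X"
  unfolding empirical_measure_def using assms
  by (intro distr_in_prob_measures prob_space_uniform_count_measure
      measurable_uniform_count_measure_borel_on) auto

lemma integral_empirical_measure: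
  fixes \<phi> :: "'a::topological_space \<Rightarrow> real"
  assumes "y \<in> {..<K} \<rightarrow> X" "continuous_on X \<phi>"
  shows "(\<integral>x. \<phi> x \<partial>empirical_measure X K y) = (\<Sum>l<K. \<phi> (y l)) / real K"
proof -
  have "(\<integral>x. \<phi> x \<partial>empirical_measure X K y) = (\<integral>l. \<phi> (y l) \<partial>uniform_count_measure {..<K})"
    unfolding empirical_measure_def using assms
    by (intro integral_distr measurable_uniform_count_measure_borel_on
        borel_measurable_continuous_on_restrict)
  then show ?thesis by (simp add: integral_uniform_count_measure)
qed

lemma abs_average_diff_le:
  fixes p q :: "nat \<Rightarrow> real"
  assumes "0 < K" "\<And>l. l < K \<Longrightarrow> \<bar>p l - q l\<bar> \<le> \<epsilon>"
  shows "\<bar>(\<Sum>l<K. p l) / real K - (\<Sum>l<K. q l) / real K\<bar> \<le> \<epsilon>"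
proof -
  have "\<bar>\<Sum>l<K. p l - q l\<bar> \<le> (\<Sum>l<K. \<bar>p l - q l\<bar>)" by (rule sum_abs)
  also have "\<dots> \<le> \<epsilon> * real K"
    using sum_bounded_above[of "{..<K}" "\<lambda>l. \<bar>p l - q l\<bar>" \<epsilon>] assms(2) by (simp add: mult.commute)
  finally show ?thesis
    using assms(1) by (simp add: sum_subtractf pos_divide_le_eq flip: diff_divide_distrib)
qed

subsection \<open>Hamming balls\<close>

definition hamming_ball :: "'i set \<Rightarrow> 'b set \<Rightarrow> ('i \<Rightarrow> 'b) \<Rightarrow> real \<Rightarrow> ('i \<Rightarrow> 'b) set" where
  "hamming_ball I A c r = {u \<in> I \<rightarrow>\<^sub>E A. real (card {i \<in> I. u i \<noteq> c i}) \<le> r}"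

lemma finite_hamming_ball: "finite I \<Longrightarrow> finite A \<Longrightarrow> finite (hamming_ball I A c r)"
  by (simp add: hamming_ball_def finite_PiE)

lemma prod_mismatches:
  fixes w :: "'c::comm_monoid_mult"
  assumes "finite I"
  shows "(\<Prod>i\<in>I. if u i = c i then 1 else w) = w ^ card {i \<in> I. u i \<noteq> c i}"
proof -
  have "(\<Prod>i\<in>I. if u i = c i then 1 else w) = (\<Prod>i\<in>{i \<in> I. u i \<noteq> c i}. w)"
    using assms by (subst prod.inter_filter) (auto intro: prod.cong)
  then show ?thesis by simp
qed

text \<open>The Chernoff weight \<open>exp (- t)\<close> per deviation turns the count into a product over the
  coordinates.\<close>

lemma card_hamming_ball_le:
  assumes "finite I" "finite A" "0 \<le> t"
  shows "real (card (hamming_ball I A c r))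
    \<le> exp (t * r + real (card A) * exp (- t) * real (card I))"
proof -
  define weight where "weight i v = (if v = c i then 1 else exp (- t))" for i v
  have weight_nonneg: "0 \<le> weight i v" for i v by (simp add: weight_def)
  have "exp (- (t * r)) \<le> (\<Prod>i\<in>I. weight i (u i))" if u: "u \<in> hamming_ball I A c r" for u
  proof -
    have "(\<Prod>i\<in>I. weight i (u i)) = exp (- (t * real (card {i \<in> I. u i \<noteq> c i})))"
      using \<open>finite I\<close> by (simp add: weight_def prod_mismatches mult.commute flip: exp_of_nat_mult)
    also have "\<dots> \<ge> exp (- (t * r))"
      using u \<open>0 \<le> t\<close> by (simp add: hamming_ball_def mult_left_mono)
    finally show ?thesis .
  qed
  then have "real (card (hamming_ball I A c r)) * exp (- (t * r)) \<le>
      (\<Sum>u\<in>hamming_ball I A c r. \<Prod>i\<in>I. weight i (u i))"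
    by (rule sum_bounded_below)
  also have "\<dots> \<le> (\<Sum>u\<in>I \<rightarrow>\<^sub>E A. \<Prod>i\<in>I. weight i (u i))"
    using assms
    by (intro sum_mono2 finite_PiE) (auto simp: hamming_ball_def weight_nonneg prod_nonneg)
  also have "\<dots> = (\<Prod>i\<in>I. \<Sum>v\<in>A. weight i v)"
    using assms by (subst prod_sum_PiE) auto
  also have "\<dots> \<le> (\<Prod>i\<in>I. exp (real (card A) * exp (- t)))"
  proof (rule prod_mono)
    fix i
    have "(\<Sum>v\<in>A. weight i v) \<le> (\<Sum>v\<in>A. (if v = c i then 1 else 0) + exp (- t))"
      by (intro sum_mono) (simp add: weight_def)
    also have "\<dots> \<le> 1 + real (card A) * exp (- t)"
      using \<open>finite A\<close> by (simp add: sum.distrib)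
    also have "\<dots> \<le> exp (real (card A) * exp (- t))" by (rule exp_ge_add_one_self)
    finally show "0 \<le> (\<Sum>v\<in>A. weight i v) \<and> (\<Sum>v\<in>A. weight i v) \<le> exp (real (card A) * exp (- t))"
      by (simp add: sum_nonneg weight_nonneg)
  qed
  also have "\<dots> = exp (real (card A) * exp (- t) * real (card I))"
    by (simp add: mult.commute flip: exp_of_nat_mult)
  finally have "real (card (hamming_ball I A c r)) \<le>
      exp (real (card A) * exp (- t) * real (card I)) / exp (- (t * r))"
    by (simp add: pos_le_divide_eq)
  then show ?thesis by (simp add: add.commute flip: exp_diff)
qed

lemma ex_hamming_radius:
  fixes A :: "'b set"
  assumes "finite A" "\<gamma> > 0"
  shows "\<exists>\<eta>>0. \<forall>(I :: 'i set) c. finite I \<longrightarrow>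
    real (card (hamming_ball I A c (\<eta> * real (card I)))) \<le> exp (\<gamma> * real (card I))"
proof -
  define t where "t = 2 * real (card A) / \<gamma>"
  define \<eta> where "\<eta> = \<gamma> / (2 * (t + 1))"
  have t: "0 \<le> t" and \<eta>: "0 < \<eta>"
    using \<open>\<gamma> > 0\<close> by (simp_all add: t_def \<eta>_def add_nonneg_pos)
  have "t * \<eta> \<le> (t + 1) * \<eta>" using \<eta> by simp
  also have "\<dots> = \<gamma> / 2"
  proof -
    have "t + 1 \<noteq> 0" using t by simp
    then show ?thesis by (simp add: \<eta>_def field_simps)
  qed
  finally have t\<eta>: "t * \<eta> \<le> \<gamma> / 2" .
  have "t \<le> exp t" using exp_ge_add_one_self[of t] by linarith
  then have "t * exp (- t) \<le> 1" by (simp add: exp_minus field_simps)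
  then have "\<gamma> / 2 * (t * exp (- t)) \<le> \<gamma> / 2" using \<open>\<gamma> > 0\<close> by (intro mult_left_le) auto
  then have weight: "real (card A) * exp (- t) \<le> \<gamma> / 2"
    using \<open>\<gamma> > 0\<close> by (simp add: t_def)
  have "real (card (hamming_ball I A c (\<eta> * real (card I)))) \<le> exp (\<gamma> * real (card I))"
    if "finite I" for I :: "'i set" and c
  proof -
    have "t * (\<eta> * real (card I)) + real (card A) * exp (- t) * real (card I) =
        (t * \<eta> + real (card A) * exp (- t)) * real (card I)"
      by (simp add: algebra_simps)
    also have "\<dots> \<le> \<gamma> * real (card I)" using t\<eta> weight by (intro mult_right_mono) auto
    finally show ?thesis
      using card_hamming_ball_le[OF that \<open>finite A\<close> t, of c "\<eta> * real (card I)"]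
      by (meson exp_le_cancel_iff order_trans)
  qed
  then show ?thesis using \<eta> by blast
qed

definition shadowing_family :: "'a topology \<Rightarrow> (nat \<Rightarrow> 'a \<Rightarrow> 'a) \<Rightarrow> (nat \<Rightarrow> nat) \<Rightarrow>
    'a set set \<Rightarrow> nat \<Rightarrow> real \<Rightarrow> (nat \<Rightarrow> 'a set) set \<Rightarrow> bool" where
  "shadowing_family T g a \<U> n r Y \<longleftrightarrow> finite Y \<and> (\<forall>c\<in>Y. \<forall>i<n. c i \<in> \<U>) \<and>
     (\<forall>x\<in>topspace T. \<exists>c\<in>Y. real (card {i \<in> {..<n}. comp_seq g (a i) x \<notin> c i}) \<le> r)"

lemma shadowing_family_mono:
  "shadowing_family T g a \<U> n r Y \<Longrightarrow> r \<le> r' \<Longrightarrow> shadowing_family T g a \<U> n r' Y"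
  unfolding shadowing_family_def by (meson order_trans)

lemma join_number_le_card_shadowing_family:
  assumes \<U>: "\<U> \<in> open_covers T" and g: "\<And>n. g n \<in> topspace T \<rightarrow> topspace T"
    and Y: "shadowing_family T g a \<U> n r Y"
    and ball_le: "\<And>c. c \<in> Y \<Longrightarrow> real (card (hamming_ball {..<n} \<U> c r)) \<le> N"
  shows "real (join_number T g a \<U> n) \<le> real (card Y) * N"
proof -
  define Z where "Z = (\<Union>c\<in>Y. hamming_ball {..<n} \<U> c r)"
  have "finite Y" using Y by (simp add: shadowing_family_def)
  have "finite \<U>" using \<U> by (simp add: open_covers_def)
  have "join_number T g a \<U> n \<le> card Z"
  proof (rule join_number_le_card[where U = "\<lambda>u. u"])
    show "finite Z" using \<open>finite Y\<close> \<open>finite \<U>\<close> by (simp add: Z_def finite_hamming_ball)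
    show "u i \<in> \<U>" if "u \<in> Z" "i < n" for u i
      using that by (auto simp: Z_def hamming_ball_def)
    fix x assume x: "x \<in> topspace T"
    then obtain c where c: "c \<in> Y" "real (card {i \<in> {..<n}. comp_seq g (a i) x \<notin> c i}) \<le> r"
      using Y unfolding shadowing_family_def by blast
    have "\<exists>U\<in>\<U>. comp_seq g (a i) x \<in> U" for i
      using comp_seq_in[of g, OF g x, of "a i"] \<U> by (auto simp: open_covers_def)
    then obtain W where W: "\<And>i. W i \<in> \<U>" "\<And>i. comp_seq g (a i) x \<in> W i" by metis
    define u where "u = (\<lambda>i\<in>{..<n}. if comp_seq g (a i) x \<in> c i then c i else W i)"
    have "card {i \<in> {..<n}. u i \<noteq> c i} \<le> card {i \<in> {..<n}. comp_seq g (a i) x \<notin> c i}"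
      by (intro card_mono) (auto simp: u_def)
    then have "u \<in> hamming_ball {..<n} \<U> c r"
      using c Y W(1) by (auto simp: hamming_ball_def u_def shadowing_family_def)
    then show "\<exists>u\<in>Z. \<forall>i<n. comp_seq g (a i) x \<in> u i"
      using c(1) W(2) unfolding Z_def by (intro bexI[of _ u]) (auto simp: u_def)
  qed
  also have "card Z \<le> (\<Sum>c\<in>Y. card (hamming_ball {..<n} \<U> c r))"
    unfolding Z_def using \<open>finite Y\<close> by (rule card_UN_le)
  finally have "real (join_number T g a \<U> n) \<le> (\<Sum>c\<in>Y. real (card (hamming_ball {..<n} \<U> c r)))"
    by (simp flip: of_nat_sum)
  also have "\<dots> \<le> real (card Y) * N" using ball_le by (rule sum_bounded_above)
  finally show ?thesis .
qed

subsection \<open>Entropy of the induced system on measures\<close>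

lemma ex_nat_divide_le:
  fixes C \<eta> :: real
  assumes "\<eta> > 0"
  shows "\<exists>K>0. C / real K \<le> \<eta>"
proof -
  obtain K :: nat where K: "max 1 (C / \<eta>) < real K" using reals_Archimedean2 by blast
  then have "0 < K" by auto
  moreover have "C / real K \<le> \<eta>" using K \<open>0 < K\<close> assms by (simp add: field_simps)
  ultimately show ?thesis by blast
qed

lemma ex_cover_small_oscillation:
  fixes X :: "'a::topological_space set" and F :: "('a \<Rightarrow> real) set"
  assumes X: "compact X" and F: "finite F" "\<And>\<phi>. \<phi> \<in> F \<Longrightarrow> continuous_on X \<phi>" and "\<epsilon> > 0"
  shows "\<exists>\<A>\<in>open_covers (top_of_set X).
    \<forall>A\<in>\<A>. \<forall>\<phi>\<in>F. \<forall>x\<in>A. \<forall>y\<in>A. \<bar>\<phi> x - \<phi> y\<bar> \<le> \<epsilon>"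
proof -
  define N where "N z = {x \<in> X. \<forall>\<phi>\<in>F. \<phi> x \<in> ball (\<phi> z) (\<epsilon> / 2)}" for z
  have N_open: "openin (top_of_set X) (N z)" for z
    unfolding N_def using F
  proof (induction F rule: finite_induct)
    case (insert \<phi> F)
    have "{x \<in> X. \<forall>\<phi>'\<in>insert \<phi> F. \<phi>' x \<in> ball (\<phi>' z) (\<epsilon> / 2)} =
        (X \<inter> \<phi> -` ball (\<phi> z) (\<epsilon> / 2)) \<inter> {x \<in> X. \<forall>\<phi>'\<in>F. \<phi>' x \<in> ball (\<phi>' z) (\<epsilon> / 2)}"
      by auto
    then show ?case
      using insert by (simp add: openin_Int continuous_openin_preimage_gen)
  qed simp
  moreover have "X \<subseteq> \<Union>(N ` X)" using \<open>\<epsilon> > 0\<close> by (auto simp: N_def)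
  ultimately obtain \<A> where \<A>: "\<A> \<subseteq> N ` X" "finite \<A>" "X \<subseteq> \<Union>\<A>"
    using X[unfolded compact_eq_openin_cover, rule_format, of "N ` X"] by blast
  show ?thesis
  proof (intro bexI[of _ \<A>] ballI)
    show "\<A> \<in> open_covers (top_of_set X)"
      using \<A> N_open unfolding open_covers_def by (auto simp: N_def)
    fix A \<phi> x y assume "A \<in> \<A>" "\<phi> \<in> F" "x \<in> A" "y \<in> A"
    then obtain z where "A = N z" using \<A>(1) by blast
    then have "\<phi> x \<in> ball (\<phi> z) (\<epsilon> / 2)" "\<phi> y \<in> ball (\<phi> z) (\<epsilon> / 2)"
      using \<open>\<phi> \<in> F\<close> \<open>x \<in> A\<close> \<open>y \<in> A\<close> unfolding N_def by blast+
    then show "\<bar>\<phi> x - \<phi> y\<bar> \<le> \<epsilon>" unfolding mem_ball dist_real_def by linarith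
  qed
qed

locale nonautonomous_system =
  fixes X :: "'a::metric_space set" and f :: "nat \<Rightarrow> 'a \<Rightarrow> 'a"
  assumes compact_X: "compact X"
    and continuous_f: "\<And>n. continuous_on X (f n)"
    and f_in: "\<And>n. f n \<in> X \<rightarrow> X"
begin

abbreviation \<M> :: "'a measure topology" where
  "\<M> \<equiv> weak_star_topology X"

abbreviation push :: "nat \<Rightarrow> 'a measure \<Rightarrow> 'a measure" where
  "push \<equiv> push_seq X f"

lemma f_in_topspace: "f n \<in> topspace (top_of_set X) \<rightarrow> topspace (top_of_set X)"
  using f_in by simp

lemma comp_seq_f_in: "comp_seq f n \<in> X \<rightarrow> X"
  using comp_seq_in[of f, OF f_in] by blast

lemma continuous_comp_seq_f: "continuous_on X (comp_seq f n)"
proof (induction n)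
  case (Suc n)
  have "comp_seq f n ` X \<subseteq> X" using comp_seq_f_in by auto
  then show ?case
    using continuous_on_compose[OF Suc continuous_on_subset[OF continuous_f]] by simp
qed simp

lemma continuous_on_comp_seq_f:
  assumes "continuous_on X \<phi>"
  shows "continuous_on X (\<lambda>x. \<phi> (comp_seq f n x))"
  using assms continuous_comp_seq_f by (rule continuous_on_compose2) (use comp_seq_f_in in auto)

lemma bounded_continuous_image:
  fixes \<phi> :: "'a \<Rightarrow> real"
  shows "continuous_on X \<phi> \<Longrightarrow> bounded (\<phi> ` X)"
  using compact_X by (intro compact_imp_bounded compact_continuous_image)

lemma push_in: "push n \<in> topspace \<M> \<rightarrow> topspace \<M>"
  by (auto simp: push_seq_def intro!: distr_in_prob_measures prob_measuresD(1)
      measurable_prob_measures continuous_f f_in)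

lemma comp_seq_push_in: "\<mu> \<in> prob_measures X \<Longrightarrow> comp_seq push n \<mu> \<in> prob_measures X"
  using comp_seq_in[of push, OF push_in] by simp

lemma comp_seq_push:
  assumes \<mu>: "\<mu> \<in> prob_measures X"
  shows "comp_seq push n \<mu> = distr \<mu> (borel_on X) (comp_seq f n)"
proof (induction n)
  case 0
  show ?case using prob_measuresD(2)[OF \<mu>] by (simp add: distr_id2)
next
  case (Suc n)
  have "comp_seq f n \<in> measurable \<mu> (borel_on X)"
    by (intro measurable_prob_measures[OF \<mu>] continuous_comp_seq_f comp_seq_f_in)
  moreover have "f n \<in> measurable (borel_on X) (borel_on X)"
    by (intro measurable_borel_on continuous_f f_in)
  ultimately show ?case using Suc by (simp add: push_seq_def distr_distr o_def)
qed

lemma integral_comp_seq_push: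
  fixes \<phi> :: "'a \<Rightarrow> real"
  assumes \<mu>: "\<mu> \<in> prob_measures X" and \<phi>: "continuous_on X \<phi>"
  shows "(\<integral>x. \<phi> x \<partial>(comp_seq push n \<mu>)) = (\<integral>x. \<phi> (comp_seq f n x) \<partial>\<mu>)"
  unfolding comp_seq_push[OF \<mu>]
  by (intro integral_distr measurable_prob_measures[OF \<mu>] continuous_comp_seq_f comp_seq_f_in
      borel_measurable_continuous_on_restrict \<phi>)

lemma push_return:
  assumes "x \<in> X"
  shows "push n (return (borel_on X) x) = return (borel_on X) (f n x)"
  unfolding push_seq_def using assms
  by (subst distr_return) (simp_all add: measurable_borel_on continuous_f f_in)

text \<open>For functions \<open>\<phi>\<^sub>U \<ge> 0\<close> that are positive exactly on \<open>U\<close>, the sets of measures \<open>\<mu>\<close> with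
  \<open>\<integral> \<phi>\<^sub>U d\<mu> > 0\<close> extend a given cover of \<open>X\<close>: they cover all measures since \<open>\<Sum>\<^sub>U \<phi>\<^sub>U > 0\<close>.\<close>

lemma ex_join_number_le_join_number_push:
  assumes \<U>: "\<U> \<in> open_covers (top_of_set X)"
  shows "\<exists>\<V>\<in>open_covers \<M>. \<forall>n. join_number (top_of_set X) f a \<U> n \<le> join_number \<M> push a \<V> n"
proof -
  have "\<exists>\<phi> :: 'a \<Rightarrow> real. continuous_on X \<phi> \<and> (\<forall>x. 0 \<le> \<phi> x) \<and> (\<forall>x\<in>X. 0 < \<phi> x \<longleftrightarrow> x \<in> U)"
    if "U \<in> \<U>" for U
    using \<U> that by (intro ex_continuous_positive_exactly_on) (simp add: open_covers_def)
  then obtain \<phi> :: "'a set \<Rightarrow> 'a \<Rightarrow> real" where \<phi>: "\<And>U. U \<in> \<U> \<Longrightarrow> continuous_on X (\<phi> U)"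
      "\<And>U x. U \<in> \<U> \<Longrightarrow> 0 \<le> \<phi> U x" "\<And>U x. U \<in> \<U> \<Longrightarrow> x \<in> X \<Longrightarrow> 0 < \<phi> U x \<longleftrightarrow> x \<in> U"
    by metis
  define V where "V U = {\<mu> \<in> prob_measures X. (\<integral>x. \<phi> U x \<partial>\<mu>) \<in> {0<..}}" for U
  have "\<exists>U\<in>\<U>. \<mu> \<in> V U" if \<mu>: "\<mu> \<in> prob_measures X" for \<mu>
  proof -
    have "\<exists>U\<in>\<U>. 0 < \<phi> U x" if "x \<in> X" for x
      using \<U> \<phi>(3) that by (auto simp: open_covers_def)
    then show ?thesis
      using ex_positive_integral[OF \<mu>, of \<U> \<phi>] \<U> \<phi>(1,2) bounded_continuous_image \<mu>
      by (auto simp: open_covers_def V_def)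
  qed
  moreover have "openin \<M> (V U)" if "U \<in> \<U>" for U
    unfolding V_def using \<phi>(1)[OF that] by (intro openin_weak_star_integral) simp_all
  ultimately have V_cover: "V ` \<U> \<in> open_covers \<M>"
    using \<U> by (auto simp: open_covers_def V_def)
  have return_in_V_iff: "return (borel_on X) x \<in> V U \<longleftrightarrow> x \<in> U" if "U \<in> \<U>" "x \<in> X" for U x
  proof -
    have "(\<integral>y. \<phi> U y \<partial>return (borel_on X) x) = \<phi> U x"
      using \<phi>(1)[OF \<open>U \<in> \<U>\<close>] \<open>x \<in> X\<close>
      by (intro integral_return borel_measurable_continuous_on_restrict) simp_all
    then show ?thesis using that \<phi>(3) by (simp add: V_def return_in_prob_measures)
  qed
  have "join_number (top_of_set X) f a \<U> n \<le> join_number \<M> push a (V ` \<U>) n" for n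
  proof (rule join_number_semiconjugate_le[OF V_cover push_in f_in_topspace])
    show "return (borel_on X) \<in> topspace (top_of_set X) \<rightarrow> topspace \<M>"
      by (simp add: return_in_prob_measures)
  qed (auto simp: push_return return_in_V_iff)
  then show ?thesis using V_cover by blast
qed

lemma comp_seq_push_in_weak_star_ball_empirical:
  assumes \<mu>: "\<mu> \<in> prob_measures X" and r: "r \<in> {..<K} \<rightarrow> X" and "0 < K"
    and F: "\<And>\<phi>. \<phi> \<in> F \<Longrightarrow> continuous_on X \<phi>"
    and average: "\<And>\<phi>. \<phi> \<in> F \<Longrightarrow>
      \<bar>(\<Sum>l<K. \<phi> (comp_seq f n (y l))) / real K - (\<integral>x. \<phi> (comp_seq f n x) \<partial>\<mu>)\<bar> < \<delta>"
    and close: "\<And>\<phi> l. \<phi> \<in> F \<Longrightarrow> l < K \<Longrightarrow> \<bar>\<phi> (comp_seq f n (y l)) - \<phi> (comp_seq f n (r l))\<bar> \<le> \<epsilon>"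
  shows "comp_seq push n \<mu> \<in> weak_star_ball X F (\<delta> + \<epsilon>) (comp_seq push n (empirical_measure X K r))"
  unfolding weak_star_ball_def mem_Collect_eq
proof (intro conjI ballI)
  show "comp_seq push n \<mu> \<in> prob_measures X" using \<mu> by (rule comp_seq_push_in)
  fix \<phi> assume \<phi>: "\<phi> \<in> F"
  have "(\<integral>x. \<phi> x \<partial>comp_seq push n \<mu>) = (\<integral>x. \<phi> (comp_seq f n x) \<partial>\<mu>)"
    by (intro integral_comp_seq_push \<mu> F \<phi>)
  moreover have "(\<integral>x. \<phi> x \<partial>comp_seq push n (empirical_measure X K r)) =
      (\<Sum>l<K. \<phi> (comp_seq f n (r l))) / real K"
    using empirical_measure_in[OF \<open>0 < K\<close> r] F[OF \<phi>]
    by (simp add: integral_comp_seq_push integral_empirical_measure[OF r] continuous_on_comp_seq_f)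
  moreover have "\<bar>(\<Sum>l<K. \<phi> (comp_seq f n (y l))) / real K -
      (\<Sum>l<K. \<phi> (comp_seq f n (r l))) / real K\<bar> \<le> \<epsilon>"
    using \<open>0 < K\<close> close[OF \<phi>] by (rule abs_average_diff_le)
  ultimately show "\<bar>(\<integral>x. \<phi> x \<partial>comp_seq push n \<mu>) -
      (\<integral>x. \<phi> x \<partial>comp_seq push n (empirical_measure X K r))\<bar> < \<delta> + \<epsilon>"
    using average[OF \<phi>] by linarith
qed

lemma ex_empirical_shadow:
  fixes F :: "('a \<Rightarrow> real) set"
  assumes \<mu>: "\<mu> \<in> prob_measures X" and F: "finite F" "\<And>\<phi>. \<phi> \<in> F \<Longrightarrow> continuous_on X \<phi>"
    and bound: "\<forall>\<phi>\<in>F. \<forall>x\<in>X. \<bar>\<phi> x\<bar> \<le> b"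
    and R: "R \<subseteq> X" "\<And>x. x \<in> X \<Longrightarrow>
      \<exists>r\<in>R. \<forall>i<n. \<forall>\<phi>\<in>F. \<bar>\<phi> (comp_seq f (a i) x) - \<phi> (comp_seq f (a i) r)\<bar> \<le> \<epsilon> / 2"
    and pos: "0 < K" "0 < \<epsilon>"
  shows "\<exists>r\<in>{..<K} \<rightarrow>\<^sub>E R. real (card {i \<in> {..<n}. comp_seq push (a i) \<mu> \<notin>
      weak_star_ball X F \<epsilon> (comp_seq push (a i) (empirical_measure X K r))})
    \<le> real (card F) * b\<^sup>2 / (real K * (\<epsilon> / 2)\<^sup>2) * real n"
proof -
  let ?g = "\<lambda>i. comp_seq f (a i)"
  interpret prob_space \<mu> using \<mu> by (rule prob_measuresD)
  have space: "space \<mu> = X" using \<mu> by (rule prob_measuresD)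
  define bad where "bad y = {i \<in> {..<n}. \<exists>\<phi>\<in>F. \<epsilon> / 2 \<le>
    \<bar>(\<Sum>l<K. \<phi> (?g i (y l))) / real K - expectation (\<lambda>x. \<phi> (?g i x))\<bar>}" for y
  have "\<exists>y. (\<forall>l<K. y l \<in> space \<mu>) \<and>
      real (card (bad y)) \<le> real (card F) * b\<^sup>2 / (real K * (\<epsilon> / 2)\<^sup>2) * real (card {..<n})"
    unfolding bad_def
  proof (rule ex_points_average_approx)
    show "(\<lambda>x. \<phi> (?g i x)) \<in> borel_measurable \<mu>" if "\<phi> \<in> F" for i \<phi>
      by (intro borel_measurable_prob_measures[OF \<mu>] continuous_on_comp_seq_f F that)
    show "\<bar>\<phi> (?g i x)\<bar> \<le> b" if "\<phi> \<in> F" "x \<in> space \<mu>" for i \<phi> x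
      using that bound comp_seq_f_in by (auto simp: space)
  qed (use F(1) pos in auto)
  then obtain y where y: "\<And>l. l < K \<Longrightarrow> y l \<in> X"
    "real (card (bad y)) \<le> real (card F) * b\<^sup>2 / (real K * (\<epsilon> / 2)\<^sup>2) * real n"
    by (auto simp: space)
  obtain nearest where nearest: "\<And>l. l < K \<Longrightarrow> nearest l \<in> R"
    "\<And>l i \<phi>. l < K \<Longrightarrow> i < n \<Longrightarrow> \<phi> \<in> F \<Longrightarrow> \<bar>\<phi> (?g i (y l)) - \<phi> (?g i (nearest l))\<bar> \<le> \<epsilon> / 2"
    using R(2)[OF y(1)] by metis
  define r where "r = restrict nearest {..<K}"
  have r: "r \<in> {..<K} \<rightarrow>\<^sub>E R" using nearest(1) by (simp add: r_def)
  have "comp_seq push (a i) \<mu> \<in> weak_star_ball X F (\<epsilon> / 2 + \<epsilon> / 2)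
      (comp_seq push (a i) (empirical_measure X K r))"
    if "i < n" "i \<notin> bad y" for i
    using that r nearest(2) R(1) \<mu> pos(1) F(2)
    by (intro comp_seq_push_in_weak_star_ball_empirical[where y = y])
      (auto simp: bad_def r_def not_le)
  then have "{i \<in> {..<n}. comp_seq push (a i) \<mu> \<notin>
      weak_star_ball X F \<epsilon> (comp_seq push (a i) (empirical_measure X K r))} \<subseteq> bad y"
    by auto
  then have "card {i \<in> {..<n}. comp_seq push (a i) \<mu> \<notin>
      weak_star_ball X F \<epsilon> (comp_seq push (a i) (empirical_measure X K r))} \<le> card (bad y)"
    by (intro card_mono) (auto simp: bad_def)
  then show ?thesis using r y(2) by (meson of_nat_mono order_trans)
qed

lemma ex_spanning_set_small_oscillation:
  assumes \<A>: "\<A> \<in> open_covers (top_of_set X)"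
    and osc: "\<forall>A\<in>\<A>. \<forall>\<phi>\<in>F. \<forall>x\<in>A. \<forall>y\<in>A. \<bar>\<phi> x - \<phi> y\<bar> \<le> \<delta>"
  obtains R where "finite R" "R \<subseteq> X" "card R \<le> join_number (top_of_set X) f a \<A> n"
    "\<And>x. x \<in> X \<Longrightarrow>
       \<exists>r\<in>R. \<forall>i<n. \<forall>\<phi>\<in>F. \<bar>\<phi> (comp_seq f (a i) x) - \<phi> (comp_seq f (a i) r)\<bar> \<le> \<delta>"
proof -
  obtain R where "finite R" "R \<subseteq> X" "card R \<le> join_number (top_of_set X) f a \<A> n"
    and span: "\<And>x. x \<in> X \<Longrightarrow>
      \<exists>r\<in>R. \<forall>i<n. \<exists>A\<in>\<A>. comp_seq f (a i) x \<in> A \<and> comp_seq f (a i) r \<in> A"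
    using ex_join_spanning_set[where g = f and a = a and n = n, OF \<A> f_in_topspace]
    unfolding topspace_euclidean_subtopology by blast
  moreover have "\<exists>r\<in>R. \<forall>i<n. \<forall>\<phi>\<in>F. \<bar>\<phi> (comp_seq f (a i) x) - \<phi> (comp_seq f (a i) r)\<bar> \<le> \<delta>"
    if "x \<in> X" for x
    using span[OF that] osc by meson
  ultimately show ?thesis using that by blast
qed

lemma ex_empirical_shadowing_family:
  fixes F :: "('a \<Rightarrow> real) set"
  assumes U: "\<And>\<mu>. \<mu> \<in> prob_measures X \<Longrightarrow> U \<mu> \<in> \<U> \<and> weak_star_ball X F \<epsilon> \<mu> \<subseteq> U \<mu>"
    and F: "finite F" "\<And>\<phi>. \<phi> \<in> F \<Longrightarrow> continuous_on X \<phi>"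
    and bound: "\<forall>\<phi>\<in>F. \<forall>x\<in>X. \<bar>\<phi> x\<bar> \<le> b"
    and \<A>: "\<A> \<in> open_covers (top_of_set X)"
    and osc: "\<forall>A\<in>\<A>. \<forall>\<phi>\<in>F. \<forall>x\<in>A. \<forall>y\<in>A. \<bar>\<phi> x - \<phi> y\<bar> \<le> \<epsilon> / 2"
    and pos: "0 < K" "0 < \<epsilon>"
  shows "\<exists>Y. card Y \<le> join_number (top_of_set X) f a \<A> n ^ K \<and>
    shadowing_family \<M> push a \<U> n (real (card F) * b\<^sup>2 / (real K * (\<epsilon> / 2)\<^sup>2) * real n) Y"
proof -
  obtain R where R: "finite R" "R \<subseteq> X" "card R \<le> join_number (top_of_set X) f a \<A> n"
    and close: "\<And>x. x \<in> X \<Longrightarrow>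
      \<exists>r\<in>R. \<forall>i<n. \<forall>\<phi>\<in>F. \<bar>\<phi> (comp_seq f (a i) x) - \<phi> (comp_seq f (a i) r)\<bar> \<le> \<epsilon> / 2"
    using ex_spanning_set_small_oscillation[OF \<A> osc] by blast
  define ball_around where
    "ball_around r i = weak_star_ball X F \<epsilon> (comp_seq push (a i) (empirical_measure X K r))" for r i
  define c where "c r i = U (comp_seq push (a i) (empirical_measure X K r))" for r i
  have c: "c r i \<in> \<U>" "ball_around r i \<subseteq> c r i" if "r \<in> {..<K} \<rightarrow>\<^sub>E R" for r i
  proof -
    have "comp_seq push (a i) (empirical_measure X K r) \<in> prob_measures X"
      using that R(2) pos(1) by (intro comp_seq_push_in empirical_measure_in) auto
    then show "c r i \<in> \<U>" "ball_around r i \<subseteq> c r i" using U by (simp_all add: c_def ball_around_def)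
  qed
  let ?\<rho> = "real (card F) * b\<^sup>2 / (real K * (\<epsilon> / 2)\<^sup>2) * real n"
  have finite_choices: "finite ({..<K} \<rightarrow>\<^sub>E R)" using R(1) by (intro finite_PiE) auto
  have shadow: "\<exists>r\<in>{..<K} \<rightarrow>\<^sub>E R. real (card {i \<in> {..<n}. comp_seq push (a i) \<mu> \<notin> c r i}) \<le> ?\<rho>"
    if \<mu>: "\<mu> \<in> prob_measures X" for \<mu>
  proof -
    obtain r where r: "r \<in> {..<K} \<rightarrow>\<^sub>E R"
      "real (card {i \<in> {..<n}. comp_seq push (a i) \<mu> \<notin> ball_around r i}) \<le> ?\<rho>"
      using ex_empirical_shadow[OF \<mu> F bound R(2) close pos] unfolding ball_around_def by blast
    have "card {i \<in> {..<n}. comp_seq push (a i) \<mu> \<notin> c r i} \<le>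
        card {i \<in> {..<n}. comp_seq push (a i) \<mu> \<notin> ball_around r i}"
      using c(2)[OF r(1)] by (intro card_mono) auto
    then show ?thesis using r by (meson of_nat_mono order_trans)
  qed
  show ?thesis
  proof (intro exI[of _ "c ` ({..<K} \<rightarrow>\<^sub>E R)"] conjI)
    have "card (c ` ({..<K} \<rightarrow>\<^sub>E R)) \<le> card R ^ K"
      using card_image_le[OF finite_choices] by (simp add: card_funcsetE)
    also have "\<dots> \<le> join_number (top_of_set X) f a \<A> n ^ K" using R(3) by (rule power_mono) simp
    finally show "card (c ` ({..<K} \<rightarrow>\<^sub>E R)) \<le> join_number (top_of_set X) f a \<A> n ^ K" .
    show "shadowing_family \<M> push a \<U> n ?\<rho> (c ` ({..<K} \<rightarrow>\<^sub>E R))"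
      unfolding shadowing_family_def topspace_weak_star_topology
      using finite_choices c(1) shadow by (intro conjI) blast+
  qed
qed

lemma ex_small_shadowing_family:
  assumes \<U>: "\<U> \<in> open_covers \<M>" and "\<eta> > 0"
  shows "\<exists>\<A>\<in>open_covers (top_of_set X). \<exists>K. \<forall>n. \<exists>Y.
    card Y \<le> join_number (top_of_set X) f a \<A> n ^ K \<and> shadowing_family \<M> push a \<U> n (\<eta> * real n) Y"
proof -
  obtain F \<epsilon> where F: "finite F" "\<And>\<phi>. \<phi> \<in> F \<Longrightarrow> continuous_on X \<phi>" and "\<epsilon> > 0"
    and "\<And>\<mu>. \<mu> \<in> prob_measures X \<Longrightarrow> \<exists>U\<in>\<U>. weak_star_ball X F \<epsilon> \<mu> \<subseteq> U"
    using weak_star_Lebesgue_number[OF compact_space_weak_star_topology[OF compact_X] \<U>] by blast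
  then obtain U where U: "\<And>\<mu>. \<mu> \<in> prob_measures X \<Longrightarrow> U \<mu> \<in> \<U> \<and> weak_star_ball X F \<epsilon> \<mu> \<subseteq> U \<mu>"
    by metis
  have "bounded (\<Union>\<phi>\<in>F. \<phi> ` X)"
    using F by (intro bounded_UN ballI bounded_continuous_image)
  then obtain b where bound: "\<forall>\<phi>\<in>F. \<forall>x\<in>X. \<bar>\<phi> x\<bar> \<le> b"
    unfolding bounded_real by blast
  obtain \<A> where \<A>: "\<A> \<in> open_covers (top_of_set X)"
    and osc: "\<forall>A\<in>\<A>. \<forall>\<phi>\<in>F. \<forall>x\<in>A. \<forall>y\<in>A. \<bar>\<phi> x - \<phi> y\<bar> \<le> \<epsilon> / 2"
    using ex_cover_small_oscillation[OF compact_X F half_gt_zero[OF \<open>\<epsilon> > 0\<close>]] by blast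
  obtain K where "0 < K" and K: "real (card F) * b\<^sup>2 / (\<epsilon> / 2)\<^sup>2 / real K \<le> \<eta>"
    using ex_nat_divide_le[OF \<open>\<eta> > 0\<close>] by blast
  then have rate_le: "real (card F) * b\<^sup>2 / (real K * (\<epsilon> / 2)\<^sup>2) * real n \<le> \<eta> * real n" for n
    by (intro mult_right_mono) (simp_all add: mult.commute)
  have "\<exists>Y. card Y \<le> join_number (top_of_set X) f a \<A> n ^ K \<and>
      shadowing_family \<M> push a \<U> n (\<eta> * real n) Y" for n
    using ex_empirical_shadowing_family[OF U F bound \<A> osc \<open>0 < K\<close> \<open>\<epsilon> > 0\<close>]
      shadowing_family_mono[OF _ rate_le] by blast
  then show ?thesis using \<A> by blast
qed

lemma ex_join_number_push_le:
  assumes \<U>: "\<U> \<in> open_covers \<M>" and "\<gamma> > 0"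
  shows "\<exists>\<A>\<in>open_covers (top_of_set X). \<exists>K. \<forall>n. real (join_number \<M> push a \<U> n)
    \<le> real (join_number (top_of_set X) f a \<A> n) ^ K * exp (\<gamma> * real n)"
proof -
  have "finite \<U>" using \<U> by (simp add: open_covers_def)
  then obtain \<eta> where "\<eta> > 0" and hamming: "\<And>(I :: nat set) c. finite I \<Longrightarrow>
      real (card (hamming_ball I \<U> c (\<eta> * real (card I)))) \<le> exp (\<gamma> * real (card I))"
    using ex_hamming_radius[OF _ \<open>\<gamma> > 0\<close>] by metis
  obtain \<A> K where \<A>: "\<A> \<in> open_covers (top_of_set X)" and family: "\<And>n. \<exists>Y.
      card Y \<le> join_number (top_of_set X) f a \<A> n ^ K \<and>
      shadowing_family \<M> push a \<U> n (\<eta> * real n) Y"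
    using ex_small_shadowing_family[OF \<U> \<open>\<eta> > 0\<close>, of a] by blast
  have "real (join_number \<M> push a \<U> n) \<le>
      real (join_number (top_of_set X) f a \<A> n) ^ K * exp (\<gamma> * real n)" for n
  proof -
    obtain Y where Y: "card Y \<le> join_number (top_of_set X) f a \<A> n ^ K"
      "shadowing_family \<M> push a \<U> n (\<eta> * real n) Y" using family by blast
    have "real (join_number \<M> push a \<U> n) \<le> real (card Y) * exp (\<gamma> * real n)"
      using hamming[of "{..<n}"]
      by (intro join_number_le_card_shadowing_family[OF \<U> push_in Y(2)]) simp
    also have "\<dots> \<le> real (join_number (top_of_set X) f a \<A> n ^ K) * exp (\<gamma> * real n)"
      using Y(1) by (intro mult_right_mono of_nat_mono) auto
    finally show ?thesis by simp
  qed
  then show ?thesis using \<A> by blast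
qed

theorem seq_entropy_push_eq_0_iff:
  "seq_entropy (top_of_set X) f a = 0 \<longleftrightarrow> seq_entropy \<M> push a = 0"
proof
  assume "seq_entropy \<M> push a = 0"
  then show "seq_entropy (top_of_set X) f a = 0"
    unfolding seq_entropy_eq_0_iff
    using ex_join_number_le_join_number_push subexponential_mono by meson
next
  assume zero: "seq_entropy (top_of_set X) f a = 0"
  show "seq_entropy \<M> push a = 0"
    unfolding seq_entropy_eq_0_iff
  proof (intro ballI subexponential_if_le_power_times_exp)
    fix \<U> and \<gamma> :: real assume "\<U> \<in> open_covers \<M>" "\<gamma> > 0"
    then show "\<exists>v K. subexponential v \<and>
        (\<forall>n. real (join_number \<M> push a \<U> n) \<le> real (v n) ^ K * exp (\<gamma> * real n))"
      using ex_join_number_push_le[of \<U> \<gamma> a] zero unfolding seq_entropy_eq_0_iff by blast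
  qed
qed

end

theorem theorem5p3:
  fixes X :: "'a::metric_space set" and f :: "nat \<Rightarrow> 'a \<Rightarrow> 'a" and a :: "nat \<Rightarrow> nat"
  assumes "compact X"
    and "\<And>n. continuous_on X (f n)"
    and "\<And>n. f n ` X \<subseteq> X"
    and "strict_mono a"
  shows "(seq_entropy (top_of_set X) f a = 0 \<longleftrightarrow>
            seq_entropy (weak_star_topology X) (push_seq X f) a = 0)
       \<and> (null_system (top_of_set X) f \<longleftrightarrow>
            null_system (weak_star_topology X) (push_seq X f))"
proof -
  interpret nonautonomous_system X f
    using assms(1-3) by unfold_locales auto
  show ?thesis
    by (simp add: null_system_def seq_entropy_push_eq_0_iff)
qed

end
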